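(* For any positive integer $N$ the estimate $$\int_{-\infty}^{+\infty}U^2(x)\,dx\ge\frac{N^2}{2},$$ valid for Dirac operators $\mathcal{D}$ on the spinor bundle $\mathcal{E}$ over $S^2$ with one-dimensional real-valued potential $U(x)=O(e^{-|x|})$ (in a cylindric representation) and with $\dim_{\bf H}\mathrm{Ker}\,\mathcal{D}\ge N$, is precise, and an equality is achieved at $$U_N(x)=\frac{N}{2\cosh x}.$$
   Context: Notation: $z=x+iy$ is a conformal parameter on the cylinder $\mathcal{Z}=\{(x,y):-\infty<x<\infty,\ y\bmod 2\pi\}$, $\partial=\frac12(\partial_x-i\partial_y)$, $\bar\partial=\frac12(\partial_x+i\partial_y)$, and $$\mathcal{D}=\begin{pmatrix}0&\partial\\-\bar\partial&0\end{pmatrix}+\begin{pmatrix}U&0\\0&U\end{pmatrix}.$$ In the cylindric representation, $\mathrm{Ker}\,\mathcal{D}$ for $\mathcal{D}$ acting on sections of $\mathcal{E}$ is the complex vector space of solutions $\psi:\mathbb{R}^2\to\mathbb{C}^2$ of $\mathcal{D}\psi=0$ with $\psi(x,y+2\pi)=-\psi(x,y)$ and $|\psi|^2=O(e^{-|x|})$ as $x\to\pm\infty$. It is finite-dimensional and invariant under $\psi=(\psi_1,\psi_2)\mapsto\psi^*=(\bar\psi_2,-\bar\psi_1)$, which satisfies $(\psi^* )^*=-\psi$; this makes it a quaternionic vector space, with $\dim_{\bf H}=\frac12\dim_{\mathbb{C}}$. That the equality is achieved at $U_N$ means that for $U=U_N$ one has $\dim_{\bf H}\mathrm{Ker}\,\mathcal{D}\ge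 N$ and $\int U_N^2\,dx=N^2/2$. *)

theory Defs
  imports "HOL-Analysis.Analysis" "HOL-Library.Landau_Symbols" "HOL-Library.Function_Algebras"
begin

type_synonym spinor = "real \<times> real \<Rightarrow> complex ^ 2"

definition partial_x :: "(real \<times> real \<Rightarrow> 'a::real_normed_vector) \<Rightarrow> real \<times> real \<Rightarrow> 'a" where
  "partial_x f = (\<lambda>(x, y). vector_derivative (\<lambda>t. f (t, y)) (at x))"

definition partial_y :: "(real \<times> real \<Rightarrow> 'a::real_normed_vector) \<Rightarrow> real \<times> real \<Rightarrow> 'a" where
  "partial_y f = (\<lambda>(x, y). vector_derivative (\<lambda>t. f (x, t)) (at y))"

definition wirtinger :: "(real \<times> real \<Rightarrow> complex) \<Rightarrow> real \<times> real \<Rightarrow> complex" where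
  "wirtinger f p = (partial_x f p - \<i> * partial_y f p) / 2"

definition wirtinger_bar :: "(real \<times> real \<Rightarrow> complex) \<Rightarrow> real \<times> real \<Rightarrow> complex" where
  "wirtinger_bar f p = (partial_x f p + \<i> * partial_y f p) / 2"

definition dirac :: "(real \<Rightarrow> real) \<Rightarrow> spinor \<Rightarrow> spinor" where
  "dirac U \<psi> p = vector
     [ wirtinger (\<lambda>q. \<psi> q $ 2) p + of_real (U (fst p)) * \<psi> p $ 1,
       - wirtinger_bar (\<lambda>q. \<psi> q $ 1) p + of_real (U (fst p)) * \<psi> p $ 2 ]"

text \<open>The operators above are total functions (\<^const>\<open>vector_derivative\<close> has an
  arbitrary value where there is no derivative), so differentiability of a
  spinor has to be required separately.\<close>

definition C1_spinor :: "spinor \<Rightarrow> bool" where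
  "C1_spinor \<psi> \<longleftrightarrow> (\<forall>p. \<psi> differentiable (at p)) \<and>
     continuous_on UNIV (partial_x \<psi>) \<and> continuous_on UNIV (partial_y \<psi>)"

text \<open>The norm on \<^typ>\<open>complex ^ 2\<close> is the Hermitian one. The growth condition is
  uniform in \<open>y\<close>, and \<^const>\<open>at_infinity\<close> on the reals covers both ends of the cylinder.\<close>

definition dirac_kernel :: "(real \<Rightarrow> real) \<Rightarrow> spinor set" where
  "dirac_kernel U = {\<psi>. C1_spinor \<psi> \<and> (\<forall>p. dirac U \<psi> p = 0) \<and>
     (\<forall>x y. \<psi> (x, y + 2 * pi) = - \<psi> (x, y)) \<and>
     (\<exists>C. \<forall>\<^sub>F x in at_infinity. \<forall>y. (norm (\<psi> (x, y)))\<^sup>2 \<le> C * exp (- \<bar>x\<bar>))}"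

definition spinor_scale :: "complex \<Rightarrow> spinor \<Rightarrow> spinor" where
  "spinor_scale c \<psi> = (\<lambda>p. c *s \<psi> p)"

interpretation spinor: vector_space spinor_scale
  by unfold_locales (auto simp: spinor_scale_def fun_eq_iff vec_eq_iff algebra_simps)

definition spinor_conj :: "spinor \<Rightarrow> spinor" where
  "spinor_conj \<psi> p = vector [cnj (\<psi> p $ 2), - cnj (\<psi> p $ 1)]"

text \<open>The quaternionic dimension of a complex subspace stable under \<^const>\<open>spinor_conj\<close>.
  As always with \<^const>\<open>vector_space.dim\<close>, the value for an infinite-dimensional
  space is \<open>0\<close>.\<close>

definition quaternionic_dim :: "spinor set \<Rightarrow> real" where
  "quaternionic_dim V = of_nat (spinor.dim V) / 2"

text \<open>No regularity of \<open>U\<close> is assumed: for a nonzero kernel it is automatic. Each Fourier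
  mode in \<open>y\<close> of a spinor in the kernel solves \<open>\<phi>\<^sub>1' = k \<phi>\<^sub>1 + 2 U \<phi>\<^sub>2\<close>,
  \<open>\<phi>\<^sub>2' = - k \<phi>\<^sub>2 - 2 U \<phi>\<^sub>1\<close>; as \<open>U\<close> is real, the derivative of \<open>|\<phi>|\<^sup>2\<close> is bounded by
  \<open>2 |k| |\<phi>|\<^sup>2\<close>, so a nonzero mode has no zeros and \<open>U\<close> is a continuous function of
  \<open>\<phi>\<close> and \<open>\<phi>'\<close>.\<close>

definition admissible :: "nat \<Rightarrow> (real \<Rightarrow> real) \<Rightarrow> bool" where
  "admissible N U \<longleftrightarrow> U \<in> O[at_infinity](\<lambda>x. exp (- \<bar>x\<bar>)) \<and>
     real N \<le> quaternionic_dim (dirac_kernel U)"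

text \<open>The structure on the kernel on which \<^const>\<open>quaternionic_dim\<close> relies.\<close>

lemma spinor_conj_conj: "spinor_conj (spinor_conj \<psi>) = - \<psi>"
  by (auto simp: spinor_conj_def fun_eq_iff vec_eq_iff forall_2)

lemma has_partials:
  assumes "f differentiable (at p)"
  shows "((\<lambda>t. f (t, snd p)) has_vector_derivative partial_x f p) (at (fst p))"
    and "((\<lambda>t. f (fst p, t)) has_vector_derivative partial_y f p) (at (snd p))"
proof -
  obtain D where D: "(f has_derivative D) (at (fst p, snd p))"
    using assms by (auto simp: differentiable_def)
  have "((\<lambda>t. f (t, snd p)) has_derivative (\<lambda>t. D (t, 0))) (at (fst p))"
    by (rule has_derivative_compose[where f = "\<lambda>t. (t, snd p)" and g = f])
       (use D in \<open>auto intro!: derivative_eq_intros\<close>)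
  then show "((\<lambda>t. f (t, snd p)) has_vector_derivative partial_x f p) (at (fst p))"
    unfolding partial_x_def case_prod_beta
    by (metis vector_derivative_works differentiableI)
  have "((\<lambda>t. f (fst p, t)) has_derivative (\<lambda>t. D (0, t))) (at (snd p))"
    by (rule has_derivative_compose[where f = "\<lambda>t. (fst p, t)" and g = f])
       (use D in \<open>auto intro!: derivative_eq_intros\<close>)
  then show "((\<lambda>t. f (fst p, t)) has_vector_derivative partial_y f p) (at (snd p))"
    unfolding partial_y_def case_prod_beta
    by (metis vector_derivative_works differentiableI)
qed

lemma partial_linear:
  assumes "f differentiable (at p)" "bounded_linear L"
  shows "partial_x (\<lambda>q. L (f q)) p = L (partial_x f p)"
    and "partial_y (\<lambda>q. L (f q)) p = L (partial_y f p)"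
  using bounded_linear.has_vector_derivative[OF assms(2) has_partials(1)[OF assms(1)]]
    bounded_linear.has_vector_derivative[OF assms(2) has_partials(2)[OF assms(1)]]
  by (auto simp: partial_x_def partial_y_def case_prod_beta intro!: vector_derivative_at)

lemma partial_add:
  assumes "f differentiable (at p)" "g differentiable (at p)"
  shows "partial_x (f + g) p = partial_x f p + partial_x g p"
    and "partial_y (f + g) p = partial_y f p + partial_y g p"
  using has_vector_derivative_add[OF has_partials(1)[OF assms(1)] has_partials(1)[OF assms(2)]]
    has_vector_derivative_add[OF has_partials(2)[OF assms(1)] has_partials(2)[OF assms(2)]]
  by (auto simp: partial_x_def partial_y_def case_prod_beta intro!: vector_derivative_at)

lemma dirac_eq_0_iff:
  assumes "\<psi> differentiable (at p)"
  shows "dirac U \<psi> p = 0 \<longleftrightarrow>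
    (partial_x \<psi> p $ 2 - \<i> * partial_y \<psi> p $ 2) / 2 + of_real (U (fst p)) * \<psi> p $ 1 = 0 \<and>
    - ((partial_x \<psi> p $ 1 + \<i> * partial_y \<psi> p $ 1) / 2) + of_real (U (fst p)) * \<psi> p $ 2 = 0"
  by (simp add: dirac_def wirtinger_def wirtinger_bar_def vec_eq_iff forall_2
      partial_linear[OF assms bounded_linear_vec_nth])

lemma C1_spinor_linear:
  assumes "C1_spinor \<psi>" "bounded_linear L"
  shows "C1_spinor (\<lambda>p. L (\<psi> p))"
proof -
  have d: "\<psi> differentiable (at p)" for p
    using assms unfolding C1_spinor_def by blast
  have "(\<lambda>p. L (\<psi> p)) differentiable (at p)" for p
    using d[of p] bounded_linear.has_derivative[OF assms(2)]
    unfolding differentiable_def by blast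
  moreover have "partial_x (\<lambda>p. L (\<psi> p)) = (\<lambda>p. L (partial_x \<psi> p))"
      "partial_y (\<lambda>p. L (\<psi> p)) = (\<lambda>p. L (partial_y \<psi> p))"
    using partial_linear[OF d assms(2)] by auto
  ultimately show ?thesis
    using assms by (auto simp: C1_spinor_def intro!: bounded_linear.continuous_on[OF assms(2)])
qed

lemma spinor_conj_kernel:
  assumes "\<psi> \<in> dirac_kernel U"
  shows "spinor_conj \<psi> \<in> dirac_kernel U"
proof -
  define L :: "complex ^ 2 \<Rightarrow> complex ^ 2" where "L v = vector [cnj (v $ 2), - cnj (v $ 1)]" for v
  have nL: "norm (L v) = norm v" for v
    by (simp add: L_def norm_vec_def L2_set_def sum_2 add.commute)
  have L: "bounded_linear L"
    by (rule bounded_linear_intro[where K = 1])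
       (auto simp: nL, auto simp: L_def vec_eq_iff forall_2 scaleR_conv_of_real[where 'a = complex])
  have eq: "spinor_conj \<psi> = (\<lambda>p. L (\<psi> p))"
    by (auto simp: spinor_conj_def L_def)
  have C: "C1_spinor \<psi>" "\<forall>p. dirac U \<psi> p = 0"
    using assms by (auto simp: dirac_kernel_def)
  then have d: "\<psi> differentiable (at p)" for p
    unfolding C1_spinor_def by blast
  have C': "C1_spinor (\<lambda>p. L (\<psi> p))"
    by (rule C1_spinor_linear[OF C(1) L])
  then have d': "(\<lambda>p. L (\<psi> p)) differentiable (at p)" for p
    unfolding C1_spinor_def by blast
  have "dirac U (\<lambda>p. L (\<psi> p)) p = 0" for p
  proof -
    have "cnj ((partial_x \<psi> p $ 2 - \<i> * partial_y \<psi> p $ 2) / 2 + of_real (U (fst p)) * \<psi> p $ 1) = 0"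
      "cnj (- ((partial_x \<psi> p $ 1 + \<i> * partial_y \<psi> p $ 1) / 2) + of_real (U (fst p)) * \<psi> p $ 2) = 0"
      using C(2)[rule_format, of p, unfolded dirac_eq_0_iff[OF d]]
      by (auto simp only: complex_cnj_zero)
    then show ?thesis
      unfolding dirac_eq_0_iff[OF d'] partial_linear[OF d L]
      by (simp add: L_def field_simps) algebra
  qed
  moreover have "L (- v) = - L v" for v
    using linear_neg[OF bounded_linear.linear[OF L]] .
  ultimately show ?thesis
    using assms C' unfolding eq by (simp add: dirac_kernel_def nL)
qed

lemma subspace_dirac_kernel: "spinor.subspace (dirac_kernel U)"
proof (rule spinor.subspaceI)
  show "0 \<in> dirac_kernel U"
    by (auto simp: dirac_kernel_def C1_spinor_def dirac_def wirtinger_def wirtinger_bar_def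
        partial_x_def partial_y_def zero_fun_def vec_eq_iff forall_2 case_prod_beta
        intro!: exI[of _ 0])
next
  fix \<psi> \<phi> assume asm: "\<psi> \<in> dirac_kernel U" "\<phi> \<in> dirac_kernel U"
  then have d: "\<psi> differentiable (at p)" "\<phi> differentiable (at p)" for p
    unfolding dirac_kernel_def C1_spinor_def by blast+
  then have ds: "(\<psi> + \<phi>) differentiable (at p)" for p
    unfolding plus_fun_def by simp
  have px: "partial_x (\<psi> + \<phi>) = (\<lambda>p. partial_x \<psi> p + partial_x \<phi> p)"
      "partial_y (\<psi> + \<phi>) = (\<lambda>p. partial_y \<psi> p + partial_y \<phi> p)"
    using partial_add[OF d] by auto
  have C: "C1_spinor (\<psi> + \<phi>)"
    using asm ds by (auto simp: C1_spinor_def dirac_kernel_def px intro!: continuous_intros)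
  have D: "dirac U (\<psi> + \<phi>) p = 0" for p
  proof -
    have "dirac U \<psi> p = 0" "dirac U \<phi> p = 0"
      using asm unfolding dirac_kernel_def by blast+
    then show ?thesis
      unfolding dirac_eq_0_iff[OF d(1)] dirac_eq_0_iff[OF d(2)] dirac_eq_0_iff[OF ds] px
        plus_fun_apply vector_add_component
      by algebra
  qed
  obtain A B where A: "\<forall>\<^sub>F x in at_infinity. \<forall>y. (norm (\<psi> (x, y)))\<^sup>2 \<le> A * exp (- \<bar>x\<bar>)"
    and B: "\<forall>\<^sub>F x in at_infinity. \<forall>y. (norm (\<phi> (x, y)))\<^sup>2 \<le> B * exp (- \<bar>x\<bar>)"
    using asm by (auto simp: dirac_kernel_def)
  have "\<forall>\<^sub>F x in at_infinity. \<forall>y. (norm ((\<psi> + \<phi>) (x, y)))\<^sup>2 \<le> (2 * A + 2 * B) * exp (- \<bar>x\<bar>)"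
    using A B
  proof eventually_elim
    case (elim x)
    show ?case
    proof
      fix y
      have "(norm ((\<psi> + \<phi>) (x, y)))\<^sup>2 \<le> (norm (\<psi> (x, y)) + norm (\<phi> (x, y)))\<^sup>2"
        by (intro power_mono) (auto simp: norm_triangle_ineq)
      also have "\<dots> \<le> 2 * (norm (\<psi> (x, y)))\<^sup>2 + 2 * (norm (\<phi> (x, y)))\<^sup>2"
        using sum_squares_bound[of "norm (\<psi> (x, y))" "norm (\<phi> (x, y))"]
        by (simp add: power2_sum)
      also have "\<dots> \<le> (2 * A + 2 * B) * exp (- \<bar>x\<bar>)"
        using elim[rule_format, of y] by (simp add: algebra_simps)
      finally show "(norm ((\<psi> + \<phi>) (x, y)))\<^sup>2 \<le> (2 * A + 2 * B) * exp (- \<bar>x\<bar>)" .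
    qed
  qed
  then show "\<psi> + \<phi> \<in> dirac_kernel U"
    using C D asm by (auto simp: dirac_kernel_def)
next
  fix c \<psi> assume asm: "\<psi> \<in> dirac_kernel U"
  define L :: "complex ^ 2 \<Rightarrow> complex ^ 2" where "L v = c *s v" for v
  have nL: "norm (L v) = cmod c * norm v" for v
    by (simp add: L_def norm_vec_def norm_mult L2_set_right_distrib)
  have L: "bounded_linear L"
    by (rule bounded_linear_intro[where K = "cmod c"])
       (auto simp: nL mult.commute, auto simp: L_def vec_eq_iff algebra_simps)
  have eq: "spinor_scale c \<psi> = (\<lambda>p. L (\<psi> p))"
    by (auto simp: spinor_scale_def L_def)
  have C: "C1_spinor \<psi>" "\<forall>p. dirac U \<psi> p = 0"
    using asm by (auto simp: dirac_kernel_def)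
  then have d: "\<psi> differentiable (at p)" for p
    unfolding C1_spinor_def by blast
  have C': "C1_spinor (\<lambda>p. L (\<psi> p))"
    by (rule C1_spinor_linear[OF C(1) L])
  then have d': "(\<lambda>p. L (\<psi> p)) differentiable (at p)" for p
    unfolding C1_spinor_def by blast
  have D: "dirac U (\<lambda>p. L (\<psi> p)) p = 0" for p
  proof -
    have "c * ((partial_x \<psi> p $ 2 - \<i> * partial_y \<psi> p $ 2) / 2 + of_real (U (fst p)) * \<psi> p $ 1) = 0"
      "c * (- ((partial_x \<psi> p $ 1 + \<i> * partial_y \<psi> p $ 1) / 2) + of_real (U (fst p)) * \<psi> p $ 2) = 0"
      using C(2)[rule_format, of p, unfolded dirac_eq_0_iff[OF d]] by (auto simp only: mult_zero_right)
    then show ?thesis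
      unfolding dirac_eq_0_iff[OF d'] partial_linear[OF d L]
      unfolding L_def vector_smult_component by (simp only: ring_distribs) (simp add: algebra_simps)
  qed
  obtain A where A: "\<forall>\<^sub>F x in at_infinity. \<forall>y. (norm (\<psi> (x, y)))\<^sup>2 \<le> A * exp (- \<bar>x\<bar>)"
    using asm by (auto simp: dirac_kernel_def)
  have "\<forall>\<^sub>F x in at_infinity. \<forall>y. (norm (L (\<psi> (x, y))))\<^sup>2 \<le> ((cmod c)\<^sup>2 * A) * exp (- \<bar>x\<bar>)"
    using A by eventually_elim (auto simp: nL power_mult_distrib mult.assoc intro!: mult_left_mono)
  moreover have "L (- v) = - L v" for v
    using linear_neg[OF bounded_linear.linear[OF L]] .
  ultimately show "spinor_scale c \<psi> \<in> dirac_kernel U"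
    using C' D asm unfolding eq by (auto simp: dirac_kernel_def)
qed

end

theory Submission
  imports Defs "HOL-Library.Periodic_Fun"
begin

text \<open>
  The Fourier mode with frequency \<open>k\<close> of a kernel spinor solves the Zakharov-Shabat system
  \<open>f' = k f + q g\<close>, \<open>g' = - k g - q f\<close> with \<open>q = 2 U\<close>, and decays at both ends. For fixed \<open>k\<close> such a
  solution is unique up to scaling, and \<open>(f, g)\<close> for \<open>k\<close> gives \<open>(g, - f)\<close> for \<open>- k\<close>, so the quaternionic
  dimension of the kernel is the number of positive half-odd \<open>k\<close> admitting a solution. A Darboux
  transformation with respect to one solution replaces \<open>q\<close> by a real potential whose squared
  \<open>L\<^sup>2\<close> norm is smaller by exactly \<open>4 k\<close>, and it keeps the solutions for all other frequencies. Iterating,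
  \<open>\<integral>q\<^sup>2 \<ge> 4 \<Sum>k\<close> over the positive frequencies, and \<open>N\<close> of them have sum at least
  \<open>1/2 + 3/2 + \<dots> = N\<^sup>2 / 2\<close>. For \<open>q = N / cosh x\<close> the transformation lowers \<open>N\<close> by one up to the sign of \<open>q\<close>;
  running it backwards produces the solutions for \<open>k = 1/2, \<dots>, N - 1/2\<close>.
\<close>

section \<open>Bound states of the Zakharov-Shabat system\<close>

text \<open>The Darboux step is exact because \<open>(q + 2 k s)^2 - q^2\<close> with
  \<open>s = bs_sin\<close> is the derivative of \<open>2 k bs_cos\<close>: the change of energy is
  a boundary term, and \<open>bs_cos\<close> runs from 1 to - 1. No decay rate is tracked for the
  transformed potentials, so the induction carries nothing about q except a bounded antiderivative
  of q^2, and bound states are only required to tend to 0. Nor is q regular a priori; the ODE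
  arguments rest on q cancelling in the derivative of f^2 + g^2. The other obstacle is that
  \<open>spinor.dim\<close> is 0 on infinite-dimensional spaces: finiteness of the spectrum has to
  be known before the 2 N solutions for N / (2 cosh x) can be counted. It comes from the same
  inequality, applied to finite sets of frequencies.\<close>

definition zs_solution :: "(real \<Rightarrow> real) \<Rightarrow> real \<Rightarrow> (real \<Rightarrow> 'a::real_normed_vector) \<Rightarrow> (real \<Rightarrow> 'a) \<Rightarrow> bool" where
  "zs_solution q k f g \<longleftrightarrow>
     (\<forall>x. (f has_vector_derivative k *\<^sub>R f x + q x *\<^sub>R g x) (at x)) \<and>
     (\<forall>x. (g has_vector_derivative - (k *\<^sub>R g x) - q x *\<^sub>R f x) (at x))"

text \<open>Real-valued although the Fourier modes are complex: q and k are real, so the real and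
  imaginary parts of a complex \<open>zs_solution\<close> are solutions again. Convergence to 0
  without a rate survives the Darboux transformation with no estimate beyond boundedness of its
  coefficients.\<close>

definition bound_state :: "(real \<Rightarrow> real) \<Rightarrow> real \<Rightarrow> (real \<Rightarrow> real) \<Rightarrow> (real \<Rightarrow> real) \<Rightarrow> bool" where
  "bound_state q k f g \<longleftrightarrow> zs_solution q k f g \<and> (f \<longlongrightarrow> 0) at_infinity \<and> (g \<longlongrightarrow> 0) at_infinity \<and>
     (\<exists>x. f x \<noteq> 0 \<or> g x \<noteq> 0)"

lemma zs_solution_real_iff:
  fixes f g :: "real \<Rightarrow> real"
  shows "zs_solution q k f g \<longleftrightarrow>
     (\<forall>x. (f has_real_derivative k * f x + q x * g x) (at x)) \<and>
     (\<forall>x. (g has_real_derivative - (k * g x) - q x * f x) (at x))"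
  by (simp add: zs_solution_def has_real_derivative_iff_has_vector_derivative)

lemma zs_solution_realD:
  fixes f g :: "real \<Rightarrow> real"
  assumes "zs_solution q k f g"
  shows "(f has_real_derivative k * f x + q x * g x) (at x)"
    and "(g has_real_derivative - (k * g x) - q x * f x) (at x)"
  using assms by (auto simp: zs_solution_real_iff)

lemma zs_solution_bounded_linear:
  assumes "zs_solution q k f g" "bounded_linear L"
  shows "zs_solution q k (\<lambda>x. L (f x)) (\<lambda>x. L (g x))"
proof -
  interpret L: bounded_linear L by fact
  show ?thesis
    using L.has_vector_derivative[of f _ "at _"] L.has_vector_derivative[of g _ "at _"] assms(1)
    by (fastforce simp: zs_solution_def L.add L.diff L.neg L.scaleR)
qed

lemma zs_solution_linear_combination:
  assumes "zs_solution q k f g" "zs_solution q k f' g'"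
  shows "zs_solution q k (\<lambda>x. f x - c *\<^sub>R f' x) (\<lambda>x. g x - c *\<^sub>R g' x)"
  using assms unfolding zs_solution_def
  by (auto intro!: derivative_eq_intros simp: algebra_simps)

lemma zs_solution_norm_deriv:
  fixes f g :: "real \<Rightarrow> real"
  assumes "zs_solution q k f g"
  shows "((\<lambda>x. (f x)\<^sup>2 + (g x)\<^sup>2) has_real_derivative 2 * k * ((f x)\<^sup>2 - (g x)\<^sup>2)) (at x)"
  by (auto intro!: derivative_eq_intros zs_solution_realD[OF assms]
      simp: algebra_simps power2_eq_square)

text \<open>The derivative of f^2 + g^2 does not involve q and is at most 2 |k| (f^2 + g^2) in
  absolute value. A Gronwall argument with an exponential weight on each side of a then gives
  uniqueness of the Cauchy problem for arbitrary q.\<close>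

lemma zs_solution_eq_0:
  fixes f g :: "real \<Rightarrow> real"
  assumes zs: "zs_solution q k f g" and "f a = 0" "g a = 0"
  shows "f x = 0 \<and> g x = 0"
proof -
  define r where "r x = (f x)\<^sup>2 + (g x)\<^sup>2" for x
  have r': "(r has_real_derivative 2 * k * ((f x)\<^sup>2 - (g x)\<^sup>2)) (at x)" for x
    using zs_solution_norm_deriv[OF zs] unfolding r_def .
  have bd: "\<bar>2 * k * ((f x)\<^sup>2 - (g x)\<^sup>2)\<bar> \<le> 2 * \<bar>k\<bar> * r x" for x
    by (auto simp: r_def abs_mult abs_le_iff intro!: mult_left_mono)
  have "r x \<le> 0"
  proof (cases "a \<le> x")
    case True
    have "r x * exp (- (2 * \<bar>k\<bar> * x)) \<le> r a * exp (- (2 * \<bar>k\<bar> * a))"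
    proof (rule DERIV_nonpos_imp_nonincreasing[OF True])
      fix t
      have "((\<lambda>x. r x * exp (- (2 * \<bar>k\<bar> * x))) has_real_derivative
          (2 * k * ((f t)\<^sup>2 - (g t)\<^sup>2) - 2 * \<bar>k\<bar> * r t) * exp (- (2 * \<bar>k\<bar> * t))) (at t)"
        by (auto intro!: derivative_eq_intros r' simp: algebra_simps)
      moreover have "(2 * k * ((f t)\<^sup>2 - (g t)\<^sup>2) - 2 * \<bar>k\<bar> * r t) * exp (- (2 * \<bar>k\<bar> * t)) \<le> 0"
        using bd[of t] by (intro mult_nonpos_nonneg) auto
      ultimately show "\<exists>y. ((\<lambda>x. r x * exp (- (2 * \<bar>k\<bar> * x))) has_real_derivative y) (at t) \<and> y \<le> 0"
        by blast
    qed
    then show ?thesis using assms(2,3) by (simp add: r_def mult_le_0_iff)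
  next
    case False
    then have "x \<le> a" by simp
    have "r x * exp (2 * \<bar>k\<bar> * x) \<le> r a * exp (2 * \<bar>k\<bar> * a)"
    proof (rule DERIV_nonneg_imp_nondecreasing[OF \<open>x \<le> a\<close>])
      fix t
      have "((\<lambda>x. r x * exp (2 * \<bar>k\<bar> * x)) has_real_derivative
          (2 * k * ((f t)\<^sup>2 - (g t)\<^sup>2) + 2 * \<bar>k\<bar> * r t) * exp (2 * \<bar>k\<bar> * t)) (at t)"
        by (auto intro!: derivative_eq_intros r' simp: algebra_simps)
      moreover have "(2 * k * ((f t)\<^sup>2 - (g t)\<^sup>2) + 2 * \<bar>k\<bar> * r t) * exp (2 * \<bar>k\<bar> * t) \<ge> 0"
        using bd[of t] by (intro mult_nonneg_nonneg) auto
      ultimately show "\<exists>y. ((\<lambda>x. r x * exp (2 * \<bar>k\<bar> * x)) has_real_derivative y) (at t) \<and> 0 \<le> y"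
        by blast
    qed
    then show ?thesis using assms(2,3) by (simp add: r_def mult_le_0_iff)
  qed
  then show ?thesis
    using sum_power2_gt_zero_iff[of "f x" "g x"] by (auto simp: r_def)
qed

lemma bound_state_nonzero:
  assumes "bound_state q k f g"
  shows "(f x)\<^sup>2 + (g x)\<^sup>2 \<noteq> 0"
  using assms zs_solution_eq_0[of q k f g x] unfolding bound_state_def sum_power2_eq_zero_iff by blast

text \<open>The system has trace zero, so the Wronskian of two solutions is constant; decay makes it
  0. The solutions are then proportional at 0, and uniqueness of the Cauchy problem extends this to
  all x.\<close>

lemma bound_state_unique:
  assumes bs: "bound_state q k f g" and zs: "zs_solution q k u v"
    and "(u \<longlongrightarrow> 0) at_infinity" "(v \<longlongrightarrow> 0) at_infinity"
  obtains c where "u = (\<lambda>x. c * f x)" "v = (\<lambda>x. c * g x)"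
proof -
  have zs': "zs_solution q k f g" and lim: "(f \<longlongrightarrow> 0) at_infinity" "(g \<longlongrightarrow> 0) at_infinity"
    using bs by (auto simp: bound_state_def)
  define W where "W x = f x * v x - g x * u x" for x
  have "(W has_real_derivative 0) (at x)" for x
    unfolding W_def
    by (auto intro!: derivative_eq_intros zs_solution_realD[OF zs] zs_solution_realD[OF zs']
        simp: algebra_simps)
  then have W_const: "W x = W 0" for x
    by (intro DERIV_isconst_all allI)
  have "(W \<longlongrightarrow> 0 * 0 - 0 * 0) at_infinity"
    unfolding W_def by (intro tendsto_intros lim assms)
  moreover have "(W \<longlongrightarrow> W 0) at_infinity"
    by (subst W_const[abs_def]) (rule tendsto_const)
  ultimately have "W 0 = 0"
    using tendsto_unique[of "at_infinity :: real filter" W "W 0" 0] trivial_limit_at_infinity by simp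
  \<comment> \<open>One of f 0, g 0 is nonzero; the vanishing Wronskian makes the quotient of that
    component right for the other one too.\<close>
  define c where "c = (if f 0 \<noteq> 0 then u 0 / f 0 else v 0 / g 0)"
  have "u 0 - c * f 0 = 0" "v 0 - c * g 0 = 0"
    using \<open>W 0 = 0\<close> bound_state_nonzero[OF bs, of 0]
    by (auto simp: c_def W_def field_simps split: if_splits)
  then have "u x - c * f x = 0 \<and> v x - c * g x = 0" for x
    using zs_solution_eq_0[OF zs_solution_linear_combination[OF zs zs', of c], of 0 x] by simp
  then show ?thesis
    by (intro that[of c]) (auto simp: fun_eq_iff)
qed

text \<open>Exchanging the components keeps k unchanged, hence positive, under x -> - x. This
  converts limits at + infinity into limits at - infinity.\<close>

lemma bound_state_reflect:
  assumes "bound_state q k f g"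
  shows "bound_state (\<lambda>x. q (- x)) k (\<lambda>x. g (- x)) (\<lambda>x. f (- x))"
proof -
  have zs: "zs_solution q k f g"
    using assms by (simp add: bound_state_def)
  have "zs_solution (\<lambda>x. q (- x)) k (\<lambda>x. g (- x)) (\<lambda>x. f (- x))"
    unfolding zs_solution_real_iff
    using zs_solution_realD(1)[OF zs, of "- x" for x, unfolded DERIV_mirror]
      zs_solution_realD(2)[OF zs, of "- x" for x, unfolded DERIV_mirror]
    by (simp add: algebra_simps)
  moreover have "filterlim uminus at_infinity (at_infinity :: real filter)"
    unfolding filterlim_at_infinity_conv_norm_at_top norm_minus_cancel by (rule filterlim_norm_at_top)
  ultimately show ?thesis
    using assms filterlim_compose[of f _ at_infinity uminus] filterlim_compose[of g _ at_infinity uminus]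
    unfolding bound_state_def by (metis add.inverse_inverse)
qed

lemma zs_solution_swap:
  fixes f g :: "real \<Rightarrow> real"
  assumes "zs_solution q k f g"
  shows "zs_solution q (- k) g (\<lambda>x. - f x)"
  unfolding zs_solution_real_iff
  using zs_solution_realD(2)[OF assms] DERIV_minus[OF zs_solution_realD(1)[OF assms]] by simp

lemma bound_state_swap:
  assumes "bound_state q k f g"
  shows "bound_state q (- k) g (\<lambda>x. - f x)"
  using assms zs_solution_swap[of q k f g] tendsto_minus[of f 0 at_infinity]
  by (auto simp: bound_state_def)

text \<open>\<open>bs_cos\<close> and \<open>bs_sin\<close> are the cosine and sine of twice the polar angle of \<open>(f, g)\<close>, so that
  \<open>((bs_cos, bs_sin), (bs_sin, - bs_cos))\<close> is the reflection \<open>R\<close> fixing \<open>(f, g)\<close>. The Darboux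
  transformation acts on solutions as \<open>l - k R\<close>.\<close>

definition bs_cos :: "(real \<Rightarrow> real) \<Rightarrow> (real \<Rightarrow> real) \<Rightarrow> real \<Rightarrow> real" where
  "bs_cos f g x = ((f x)\<^sup>2 - (g x)\<^sup>2) / ((f x)\<^sup>2 + (g x)\<^sup>2)"

definition bs_sin :: "(real \<Rightarrow> real) \<Rightarrow> (real \<Rightarrow> real) \<Rightarrow> real \<Rightarrow> real" where
  "bs_sin f g x = 2 * f x * g x / ((f x)\<^sup>2 + (g x)\<^sup>2)"

lemma bs_cos_sin:
  assumes "bound_state q k f g"
  shows "(bs_cos f g x)\<^sup>2 + (bs_sin f g x)\<^sup>2 = 1"
proof -
  have "((f x)\<^sup>2 - (g x)\<^sup>2)\<^sup>2 + (2 * f x * g x)\<^sup>2 = ((f x)\<^sup>2 + (g x)\<^sup>2)\<^sup>2"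
    by algebra
  then show ?thesis
    using bound_state_nonzero[OF assms, of x]
    by (simp add: bs_cos_def bs_sin_def power_divide flip: add_divide_distrib)
qed

text \<open>With \<theta> the polar angle of (f, g), the amplitude drops out of \<theta>' = - (q + k
  sin 2\<theta>); these are the resulting derivatives of cos 2\<theta> and sin 2\<theta>.\<close>

lemma bs_deriv:
  assumes "bound_state q k f g"
  shows "(bs_cos f g has_real_derivative 2 * (q x + k * bs_sin f g x) * bs_sin f g x) (at x)"
    and "(bs_sin f g has_real_derivative - 2 * (q x + k * bs_sin f g x) * bs_cos f g x) (at x)"
proof -
  have zs: "zs_solution q k f g"
    using assms by (simp add: bound_state_def)
  note nz = bound_state_nonzero[OF assms, of x]
  define r where "r = (f x)\<^sup>2 + (g x)\<^sup>2"
  have "r \<noteq> 0" using nz by (simp add: r_def)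
  let ?F = "k * f x + q x * g x" and ?G = "- (k * g x) - q x * f x" and ?R = "2 * k * ((f x)\<^sup>2 - (g x)\<^sup>2)"
  have "(bs_cos f g has_real_derivative
     ((2 * f x * ?F - 2 * g x * ?G) * r - ((f x)\<^sup>2 - (g x)\<^sup>2) * ?R) / (r * r)) (at x)"
    unfolding bs_cos_def r_def
    by (rule DERIV_divide) (use nz in \<open>auto intro!: derivative_eq_intros zs_solution_realD[OF zs] zs_solution_norm_deriv[OF zs]\<close>)
  moreover have "((2 * f x * ?F - 2 * g x * ?G) * r - ((f x)\<^sup>2 - (g x)\<^sup>2) * ?R)
    = 2 * (q x * r + k * (2 * f x * g x)) * (2 * f x * g x)"
    unfolding r_def by algebra
  ultimately show "(bs_cos f g has_real_derivative 2 * (q x + k * bs_sin f g x) * bs_sin f g x) (at x)"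
    using \<open>r \<noteq> 0\<close> unfolding bs_sin_def r_def[symmetric] by (simp add: divide_simps)
  have "(bs_sin f g has_real_derivative
     ((2 * ?F * g x + 2 * f x * ?G) * r - (2 * f x * g x) * ?R) / (r * r)) (at x)"
    unfolding bs_sin_def r_def
    by (rule DERIV_divide) (use nz in \<open>auto intro!: derivative_eq_intros zs_solution_realD[OF zs] zs_solution_norm_deriv[OF zs]\<close>)
  moreover have "((2 * ?F * g x + 2 * f x * ?G) * r - (2 * f x * g x) * ?R)
    = - 2 * (q x * r + k * (2 * f x * g x)) * ((f x)\<^sup>2 - (g x)\<^sup>2)"
    unfolding r_def by algebra
  ultimately show "(bs_sin f g has_real_derivative - 2 * (q x + k * bs_sin f g x) * bs_cos f g x) (at x)"
    using \<open>r \<noteq> 0\<close> unfolding bs_sin_def bs_cos_def r_def[symmetric] by (simp add: divide_simps)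
qed

definition darboux :: "(real \<Rightarrow> real) \<Rightarrow> real \<Rightarrow> (real \<Rightarrow> real) \<Rightarrow> (real \<Rightarrow> real) \<Rightarrow> real \<Rightarrow> real" where
  "darboux q k f g x = q x + 2 * k * bs_sin f g x"

text \<open>The matrix l - k R carries solutions for q to solutions for the new potential. Its
  entries are bounded, so decay is preserved, and its determinant is l^2 - k^2, as the reflection R
  has eigenvalues 1 and - 1; so nonzero solutions stay nonzero.\<close>

lemma darboux_bound_state:
  assumes bs: "bound_state q k f g" and bs': "bound_state q l u v" and "l\<^sup>2 \<noteq> k\<^sup>2"
  shows "\<exists>u' v'. bound_state (darboux q k f g) l u' v'"
proof -
  have zs: "zs_solution q l u v" and lim: "(u \<longlongrightarrow> 0) at_infinity" "(v \<longlongrightarrow> 0) at_infinity"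
    using bs' by (auto simp: bound_state_def)
  define c s where "c = bs_cos f g" and "s = bs_sin f g"
  note cs = bs_cos_sin[OF bs, folded c_def s_def]
  note d = bs_deriv[OF bs, folded c_def s_def]
  define u' v' where "u' x = l * u x - k * (c x * u x + s x * v x)"
    and "v' x = l * v x - k * (s x * u x - c x * v x)" for x
  have "(u' has_real_derivative l * u' x + darboux q k f g x * v' x) (at x)" for x
  proof -
    have "(u' has_real_derivative l * (l * u x + q x * v x) -
      k * (2 * (q x + k * s x) * s x * u x + c x * (l * u x + q x * v x)
         + (- 2 * (q x + k * s x) * c x) * v x + s x * (- (l * v x) - q x * u x))) (at x)"
      unfolding u'_def by (auto intro!: derivative_eq_intros zs_solution_realD[OF zs] d simp: algebra_simps)
    moreover have "l * (l * u x + q x * v x) -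
      k * (2 * (q x + k * s x) * s x * u x + c x * (l * u x + q x * v x)
         + (- 2 * (q x + k * s x) * c x) * v x + s x * (- (l * v x) - q x * u x))
      = l * u' x + darboux q k f g x * v' x"
      unfolding u'_def v'_def darboux_def s_def[symmetric] by algebra
    ultimately show ?thesis by simp
  qed
  moreover have "(v' has_real_derivative - (l * v' x) - darboux q k f g x * u' x) (at x)" for x
  proof -
    have "(v' has_real_derivative l * (- (l * v x) - q x * u x) -
      k * ((- 2 * (q x + k * s x) * c x) * u x + s x * (l * u x + q x * v x)
         - 2 * (q x + k * s x) * s x * v x - c x * (- (l * v x) - q x * u x))) (at x)"
      unfolding v'_def by (auto intro!: derivative_eq_intros zs_solution_realD[OF zs] d simp: algebra_simps)
    moreover have "l * (- (l * v x) - q x * u x) -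
      k * ((- 2 * (q x + k * s x) * c x) * u x + s x * (l * u x + q x * v x)
         - 2 * (q x + k * s x) * s x * v x - c x * (- (l * v x) - q x * u x))
      = - (l * v' x) - darboux q k f g x * u' x"
      unfolding u'_def v'_def darboux_def s_def[symmetric] by algebra
    ultimately show ?thesis by simp
  qed
  moreover have cs_bd: "\<bar>c x\<bar> \<le> 1" "\<bar>s x\<bar> \<le> 1" for x
    using cs[of x] zero_le_power2[of "s x"] zero_le_power2[of "c x"]
    unfolding abs_square_le_1[symmetric] by linarith+
  have bounded: "\<forall>\<^sub>F x in at_infinity. norm (c x) \<le> 1" "\<forall>\<^sub>F x in at_infinity. norm (s x) \<le> 1"
    by (simp_all add: cs_bd)
  have "(u' \<longlongrightarrow> l * 0 - k * (0 + 0)) at_infinity" "(v' \<longlongrightarrow> l * 0 - k * (0 - 0)) at_infinity"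
    unfolding u'_def v'_def
    by (intro tendsto_intros lim lim_null_mult_left_bounded[OF bounded(1)] lim_null_mult_left_bounded[OF bounded(2)])+
  moreover have "u' 0 \<noteq> 0 \<or> v' 0 \<noteq> 0"
  proof (rule ccontr)
    assume "\<not> ?thesis"
    then have "l * u 0 = k * (c 0 * u 0 + s 0 * v 0)" "l * v 0 = k * (s 0 * u 0 - c 0 * v 0)"
      by (auto simp: u'_def v'_def)
    \<comment> \<open>R is orthogonal: take squared norms on both sides of l w = k R w.\<close>
    then have "l\<^sup>2 * ((u 0)\<^sup>2 + (v 0)\<^sup>2) = k\<^sup>2 * ((u 0)\<^sup>2 + (v 0)\<^sup>2)"
      using cs[of 0] by algebra
    then show False
      using \<open>l\<^sup>2 \<noteq> k\<^sup>2\<close> bound_state_nonzero[OF bs', of 0] by simp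
  qed
  ultimately show ?thesis
    unfolding bound_state_def zs_solution_real_iff by auto
qed

section \<open>Energy bounds the sum of the positive frequencies\<close>

lemma mono_if_deriv_square:
  fixes F h :: "real \<Rightarrow> real"
  assumes "\<And>x. (F has_real_derivative (h x)\<^sup>2) (at x)"
  shows "mono F"
proof (rule monoI)
  fix x y :: real assume "x \<le> y"
  then show "F x \<le> F y"
    by (rule DERIV_nonneg_imp_nondecreasing) (use assms in \<open>meson zero_le_power2\<close>)
qed

lemma mono_bounded_tendsto_at_top:
  fixes F :: "real \<Rightarrow> real"
  assumes "mono F" "\<And>x. F x \<le> B"
  obtains L where "(F \<longlongrightarrow> L) at_top" "L \<le> B"
proof
  have bdd: "bdd_above (range F)"
    using assms(2) by (intro bdd_aboveI[of _ B]) auto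
  show "(F \<longlongrightarrow> (SUP x. F x)) at_top"
  proof (rule increasing_tendsto)
    show "\<forall>\<^sub>F n in at_top. F n \<le> (SUP x. F x)"
      using bdd by (intro always_eventually allI cSUP_upper) auto
    fix y assume "y < (SUP x. F x)"
    then obtain x where "y < F x"
      using less_cSUP_iff[OF _ bdd, of y] by auto
    then show "\<forall>\<^sub>F n in at_top. y < F n"
      unfolding eventually_at_top_linorder using assms(1) by (meson less_le_trans monoD)
  qed
  show "(SUP x. F x) \<le> B"
    using assms(2) by (intro cSUP_least) auto
qed

text \<open>An antiderivative \<open>Q\<close> of \<open>q\<^sup>2\<close> takes the place of the \<open>L\<^sup>2\<close> norm of \<open>q\<close>, and the Darboux
  transformation changes it to \<open>Q + 2 k bs_cos\<close>. Both are monotone and bounded, so \<open>bs_cos\<close> has a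
  limit; a limit inside \<open>(- 1, 0]\<close> would make \<open>bs_sin\<^sup>2\<close>, hence \<open>q\<^sup>2\<close> plus its transform, not
  integrable, and a positive one would make the bound state grow.\<close>

lemma bs_cos_tendsto:
  assumes bs: "bound_state q k f g" and "k > 0"
    and Q: "\<And>x. (Q has_real_derivative (q x)\<^sup>2) (at x)" and Q_le: "\<And>x. Q x \<le> B"
  shows "(bs_cos f g \<longlongrightarrow> - 1) at_top"
proof -
  have zs: "zs_solution q k f g"
    and lim_infinity: "(f \<longlongrightarrow> 0) at_infinity" "(g \<longlongrightarrow> 0) at_infinity"
    using bs by (auto simp: bound_state_def)
  note lim = lim_infinity[THEN tendsto_mono[OF at_top_le_at_infinity]]
  define c s where "c = bs_cos f g" and "s = bs_sin f g"
  note cs = bs_cos_sin[OF bs, folded c_def s_def]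
  note d = bs_deriv[OF bs, folded c_def s_def]
  have c_le: "\<bar>c x\<bar> \<le> 1" for x
    using cs[of x] zero_le_power2[of "s x"] by (subst abs_square_le_1[symmetric]) linarith
  define R where "R x = Q x + 2 * k * c x" for x
  have R: "(R has_real_derivative (q x + 2 * k * s x)\<^sup>2) (at x)" for x
    unfolding R_def by (auto intro!: derivative_eq_intros Q d simp: power2_eq_square algebra_simps)
  have "mono Q" "mono R"
    using mono_if_deriv_square[OF Q] mono_if_deriv_square[OF R] by auto
  have R_le: "R x \<le> B + 2 * k" for x
  proof -
    have "2 * k * c x \<le> 2 * k * 1"
      using c_le[of x] \<open>k > 0\<close> by (intro mult_left_mono) auto
    then show ?thesis
      using Q_le[of x] by (simp add: R_def)
  qed
  obtain L where L: "(Q \<longlongrightarrow> L) at_top"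
    using mono_bounded_tendsto_at_top[OF \<open>mono Q\<close> Q_le] .
  obtain M where M: "(R \<longlongrightarrow> M) at_top"
    using mono_bounded_tendsto_at_top[OF \<open>mono R\<close> R_le] .
  define l where "l = (M - L) / (2 * k)"
  have "((\<lambda>x. (R x - Q x) / (2 * k)) \<longlongrightarrow> l) at_top"
    unfolding l_def using \<open>k > 0\<close> by (intro tendsto_intros L M) auto
  then have c: "(c \<longlongrightarrow> l) at_top"
    using \<open>k > 0\<close> by (simp add: R_def)
  have "l \<ge> - 1"
  proof (rule tendsto_lowerbound[OF c])
    have "- 1 \<le> c x" for x
      using c_le[of x] by linarith
    then show "\<forall>\<^sub>F x in at_top. - 1 \<le> c x"
      by simp
  qed simp
  have "\<not> l > 0"
  proof
    assume "l > 0"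
    then have "\<forall>\<^sub>F x in at_top. c x > 0"
      using order_tendstoD(1)[OF c] by blast
    then obtain X where X: "c x > 0" if "x \<ge> X" for x
      by (auto simp: eventually_at_top_linorder)
    define r where "r x = (f x)\<^sup>2 + (g x)\<^sup>2" for x
    have "r X \<le> r x" if "x \<ge> X" for x
    proof (rule DERIV_nonneg_imp_nondecreasing[OF that])
      fix t assume "X \<le> t"
      have "(f t)\<^sup>2 - (g t)\<^sup>2 \<ge> 0"
        using X[OF \<open>X \<le> t\<close>] by (auto simp: c_def bs_cos_def zero_less_divide_iff not_sum_power2_lt_zero)
      then show "\<exists>y. (r has_real_derivative y) (at t) \<and> 0 \<le> y"
        using zs_solution_norm_deriv[OF zs, of t] \<open>k > 0\<close> unfolding r_def by force
    qed
    then have "\<forall>\<^sub>F x in at_top. r X \<le> r x"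
      by (auto simp: eventually_at_top_linorder)
    moreover have "(r \<longlongrightarrow> 0\<^sup>2 + 0\<^sup>2) at_top"
      unfolding r_def by (intro tendsto_intros lim)
    ultimately have "r X \<le> 0"
      using tendsto_lowerbound[of r "0\<^sup>2 + 0\<^sup>2" at_top "r X"] by simp
    then show False
      using bound_state_nonzero[OF bs, of X] sum_power2_gt_zero_iff[of "f X" "g X"] by (auto simp: r_def)
  qed
  moreover have "\<not> (- 1 < l \<and> l \<le> 0)"
  proof
    assume l: "- 1 < l \<and> l \<le> 0"
    then have "l\<^sup>2 < 1"
      by (simp add: abs_square_less_1)
    define \<delta> where "\<delta> = (1 - l\<^sup>2) / 2"
    have "\<delta> > 0" using \<open>l\<^sup>2 < 1\<close> by (simp add: \<delta>_def)
    have "((\<lambda>x. 1 - (c x)\<^sup>2) \<longlongrightarrow> 1 - l\<^sup>2) at_top"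
      by (intro tendsto_intros c)
    moreover have "1 - l\<^sup>2 > \<delta>"
      using \<open>\<delta> > 0\<close> by (simp add: \<delta>_def)
    ultimately have "\<forall>\<^sub>F x in at_top. 1 - (c x)\<^sup>2 > \<delta>"
      by (rule order_tendstoD)
    then obtain X where X: "1 - (c x)\<^sup>2 > \<delta>" if "x \<ge> X" for x
      by (auto simp: eventually_at_top_linorder)
    define D where "D = 4 * k\<^sup>2 * \<delta>"
    \<comment> \<open>G is nondecreasing from X on while Q and R stay bounded, so the linear term D
      x would have to stay bounded as well.\<close>
    define G where "G x = 2 * Q x + 2 * R x - D * x" for x
    have G_mono: "G X \<le> G x" if "x \<ge> X" for x
    proof (rule DERIV_nonneg_imp_nondecreasing[OF that])
      fix t assume "X \<le> t"
      let ?y = "2 * (q t)\<^sup>2 + 2 * (q t + 2 * k * s t)\<^sup>2 - D"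
      have "(s t)\<^sup>2 \<ge> \<delta>"
        using X[OF \<open>X \<le> t\<close>] cs[of t] by simp
      then have "4 * k\<^sup>2 * (s t)\<^sup>2 \<ge> 4 * k\<^sup>2 * \<delta>"
        by (intro mult_left_mono) auto
      \<comment> \<open>Parallelogram identity for q and its transform, which differ by 2 k s: where
        s is not small, they cannot both be small.\<close>
      moreover have "2 * (q t)\<^sup>2 + 2 * (q t + 2 * k * s t)\<^sup>2 = 4 * k\<^sup>2 * (s t)\<^sup>2 + (2 * q t + 2 * k * s t)\<^sup>2"
        by algebra
      ultimately have "?y \<ge> 0"
        using zero_le_power2[of "2 * q t + 2 * k * s t"] unfolding D_def by linarith
      moreover have "(G has_real_derivative ?y) (at t)"
        unfolding G_def by (auto intro!: derivative_eq_intros Q R)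
      ultimately show "\<exists>y. (G has_real_derivative y) (at t) \<and> 0 \<le> y"
        by blast
    qed
    have "D > 0" using \<open>k > 0\<close> \<open>\<delta> > 0\<close> by (simp add: D_def)
    define E where "E = 2 * B + 2 * (B + 2 * k) - G X"
    have "D * x \<le> E" if "x \<ge> X" for x
      using G_mono[OF that] Q_le[of x] R_le[of x] unfolding G_def[of x] E_def
      by (auto simp: algebra_simps)
    from this[of "max X ((E + 1) / D)"] have "D * max X ((E + 1) / D) \<le> E" by simp
    moreover have "D * ((E + 1) / D) \<le> D * max X ((E + 1) / D)"
      using \<open>D > 0\<close> by (intro mult_left_mono) auto
    ultimately show False
      using \<open>D > 0\<close> by simp
  qed
  ultimately have "l = - 1"
    using \<open>l \<ge> - 1\<close> by linarith
  then show ?thesis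
    using c by (simp add: c_def)
qed

text \<open>Since \<open>bs_cos\<close> tends to 1 at - infinity and to - 1 at + infinity, removing
  the frequency k shrinks the window [A, B] of the antiderivative by 2 k at each end. Stating the
  bound through an arbitrary Q with values in a window lets the induction hypothesis apply to
  \<open>darboux q k f g\<close> at once.\<close>

lemma sum_bound_states_le:
  assumes "finite K" "\<And>k. k \<in> K \<Longrightarrow> k > 0 \<and> (\<exists>f g. bound_state q k f g)"
    and "\<And>x. (Q has_real_derivative (q x)\<^sup>2) (at x)" "\<And>x. A \<le> Q x" "\<And>x. Q x \<le> B"
  shows "4 * \<Sum>K \<le> B - A"
  using assms
proof (induction K arbitrary: q Q A B rule: finite_induct)
  case empty
  then show ?case using order_trans[of A "Q 0" B] by simp
next
  case (insert k K)
  note Q = insert.prems(2)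
  obtain f g where bs: "bound_state q k f g" and "k > 0"
    using insert.prems(1) by blast
  define R where "R x = Q x + 2 * k * bs_cos f g x" for x
  have R: "(R has_real_derivative (darboux q k f g x)\<^sup>2) (at x)" for x
    unfolding R_def darboux_def
    by (auto intro!: derivative_eq_intros Q bs_deriv[OF bs] simp: power2_eq_square algebra_simps)
  then have "mono R"
    by (rule mono_if_deriv_square)
  have top: "(bs_cos f g \<longlongrightarrow> - 1) at_top"
    using bs_cos_tendsto[OF bs \<open>k > 0\<close> Q insert.prems(4)] .
  \<comment> \<open>The reflected potential has the antiderivative - Q (- x), and the lower bound A
    of Q becomes its upper bound - A.\<close>
  have Q': "((\<lambda>x. - Q (- x)) has_real_derivative (q (- x))\<^sup>2) (at x)" for x
    using DERIV_minus[OF Q[of "- x", unfolded DERIV_mirror]] by simp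
  have "(bs_cos (\<lambda>x. g (- x)) (\<lambda>x. f (- x)) \<longlongrightarrow> - 1) at_top"
    by (rule bs_cos_tendsto[OF bound_state_reflect[OF bs] \<open>k > 0\<close> Q', where B = "- A"])
       (simp add: insert.prems(3))
  moreover have "bs_cos (\<lambda>x. g (- x)) (\<lambda>x. f (- x)) = (\<lambda>x. - bs_cos f g (- x))"
    by (simp add: bs_cos_def fun_eq_iff add.commute minus_divide_left)
  ultimately have "((\<lambda>x. bs_cos f g (- x)) \<longlongrightarrow> 1) at_top"
    using tendsto_minus_cancel[of "\<lambda>x. bs_cos f g (- x)" 1 at_top] by simp
  then have bot: "(bs_cos f g \<longlongrightarrow> 1) at_bot"
    by (simp add: filterlim_at_bot_mirror)
  \<comment> \<open>R x is at most R y for y \<ge> x, and R y is at most B + 2 k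
    \<open>bs_cos f g y\<close>; let y tend to infinity.\<close>
  have "R x \<le> B - 2 * k" for x
  proof -
    have "((\<lambda>y. B + 2 * k * bs_cos f g y) \<longlongrightarrow> B + 2 * k * (- 1)) at_top"
      by (intro tendsto_intros top)
    moreover have "\<forall>\<^sub>F y in at_top. R x \<le> B + 2 * k * bs_cos f g y"
      using eventually_ge_at_top[of x]
    proof eventually_elim
      case (elim y)
      show ?case
        using monoD[OF \<open>mono R\<close> elim] insert.prems(4)[of y] unfolding R_def[of y] by linarith
    qed
    ultimately show ?thesis
      using tendsto_lowerbound by fastforce
  qed
  moreover have "A + 2 * k \<le> R x" for x
  proof -
    have "((\<lambda>y. A + 2 * k * bs_cos f g y) \<longlongrightarrow> A + 2 * k * 1) at_bot"
      by (intro tendsto_intros bot)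
    moreover have "\<forall>\<^sub>F y in at_bot. A + 2 * k * bs_cos f g y \<le> R x"
      using eventually_le_at_bot[of x]
    proof eventually_elim
      case (elim y)
      show ?case
        using monoD[OF \<open>mono R\<close> elim] insert.prems(3)[of y] unfolding R_def[of y] by linarith
    qed
    ultimately show ?thesis
      using tendsto_upperbound by fastforce
  qed
  moreover have "l > 0 \<and> (\<exists>u v. bound_state (darboux q k f g) l u v)" if "l \<in> K" for l
  proof -
    have "l > 0" and ex: "\<exists>u v. bound_state q l u v"
      using insert.prems(1) that by blast+
    \<comment> \<open>Restricting to positive frequencies matters here: the transformation
      degenerates at l = - k as well as at l = k.\<close>
    moreover have "l\<^sup>2 \<noteq> k\<^sup>2"
      using that insert.hyps(2) \<open>k > 0\<close> \<open>l > 0\<close> by (auto simp: power2_eq_iff)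
    ultimately show ?thesis
      using darboux_bound_state[OF bs] by blast
  qed
  ultimately have "4 * \<Sum>K \<le> (B - 2 * k) - (A + 2 * k)"
    using insert.IH[OF _ R] by blast
  then show ?case
    using insert.hyps by simp
qed

section \<open>Fourier uniqueness\<close>

text \<open>Generated from monomials by sums, so that linear statements follow by induction without
  finite families of coefficients.\<close>

inductive trig_poly :: "(real \<Rightarrow> complex) \<Rightarrow> bool" where
  trig_poly_monom: "trig_poly (\<lambda>y. a * cis (of_int n * y))"
| trig_poly_add: "trig_poly S \<Longrightarrow> trig_poly T \<Longrightarrow> trig_poly (\<lambda>y. S y + T y)"

lemma trig_poly_mult_monom:
  assumes "trig_poly T"
  shows "trig_poly (\<lambda>y. a * cis (of_int n * y) * T y)"
  using assms
proof induction
  case (trig_poly_monom b m)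
  then show ?case
    using trig_poly.trig_poly_monom[of "a * b" "n + m"]
    by (simp add: cis_mult algebra_simps flip: cis_mult)
next
  case (trig_poly_add S T)
  then show ?case
    using trig_poly.trig_poly_add[OF trig_poly_add.IH] by (simp add: algebra_simps)
qed

lemma trig_poly_mult:
  assumes "trig_poly S" "trig_poly T"
  shows "trig_poly (\<lambda>y. S y * T y)"
  using assms(1)
proof induction
  case (trig_poly_monom b m)
  then show ?case by (rule trig_poly_mult_monom[OF assms(2)])
next
  case (trig_poly_add S' S'')
  then show ?case
    using trig_poly.trig_poly_add[OF trig_poly_add.IH] by (simp add: algebra_simps)
qed

lemma trig_poly_const: "trig_poly (\<lambda>y. a)"
  using trig_poly_monom[of a 0] by simp

lemma trig_poly_real_polynomial:
  fixes p :: "complex \<Rightarrow> real"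
  assumes "real_polynomial_function p"
  shows "trig_poly (\<lambda>y. complex_of_real (p (cis y)))"
  using assms
proof induction
  case (linear L)
  interpret bounded_linear L by fact
  have cis: "cis y = cos y *\<^sub>R 1 + sin y *\<^sub>R \<i>" for y
    by (simp add: complex_eq_iff)
  \<comment> \<open>Euler's formulas applied to L 1 cos y + L \<i> sin y.\<close>
  have "complex_of_real (L (cis y)) = (L 1 - \<i> * L \<i>) / 2 * cis (of_int 1 * y) + (L 1 + \<i> * L \<i>) / 2 * cis (of_int (- 1) * y)" for y
    unfolding cis add scaleR by (simp add: complex_eq_iff field_simps)
  then show ?case
    using trig_poly_add[OF trig_poly_monom trig_poly_monom] by presburger
next
  case (const c)
  then show ?case by (rule trig_poly_const)
next
  case (add f g)
  then show ?case
    using trig_poly_add by simp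
next
  case (mult f g)
  then show ?case
    using trig_poly_mult by simp
qed

lemma trig_poly_polynomial:
  fixes p :: "complex \<Rightarrow> complex"
  assumes "polynomial_function p"
  shows "trig_poly (\<lambda>y. p (cis y))"
proof -
  have "real_polynomial_function (\<lambda>z. Re (p z))" "real_polynomial_function (\<lambda>z. Im (p z))"
    using assms bounded_linear_Re bounded_linear_Im by (auto simp: polynomial_function_def o_def)
  then have "trig_poly (\<lambda>y. complex_of_real (Re (p (cis y))) + \<i> * complex_of_real (Im (p (cis y))))"
    by (intro trig_poly_add trig_poly_mult trig_poly_const trig_poly_real_polynomial)
  then show ?thesis
    by (simp flip: complex_eq)
qed

lemma trig_poly_continuous: "trig_poly T \<Longrightarrow> continuous_on X T"
  by (induction rule: trig_poly.induct) (auto intro!: continuous_intros)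

text \<open>Equal end values let u descend to the unit circle, where Stone-Weierstrass supplies a
  polynomial in the real coordinates; along \<open>cis\<close> such a polynomial is
  trigonometric.\<close>

lemma trig_poly_approx:
  fixes u :: "real \<Rightarrow> complex"
  assumes u: "continuous_on {0..2 * pi} u" and eq: "u (2 * pi) = u 0" and "e > 0"
  obtains T where "trig_poly T" "\<And>y. y \<in> {0..2 * pi} \<Longrightarrow> cmod (u y - T y) < e"
proof -
  define p where "p t = u (2 * pi * t)" for t
  define F where "F = p \<circ> (\<lambda>z. Arg2pi z / (2 * pi))"
  have "path p"
    unfolding path_def p_def
    by (rule continuous_on_compose2[OF u]) (auto intro!: continuous_intros simp: mult_left_le)
  \<comment> \<open>The trivial homotopy from p to itself serves only to obtain continuity of the
    induced circle map F, including at 1, where \<open>Arg2pi\<close> jumps.\<close>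
  then have "homotopic_loops UNIV p p"
    using eq by (simp add: homotopic_loops_refl p_def pathfinish_def pathstart_def)
  from homotopic_with_imp_continuous[OF homotopic_loops_imp_homotopic_circlemaps[OF this]]
  have "continuous_on (sphere 0 1) F"
    by (simp add: F_def)
  then obtain g where g: "polynomial_function g" "\<And>z. z \<in> sphere 0 1 \<Longrightarrow> cmod (F z - g z) < e"
    using Stone_Weierstrass_polynomial_function[of "sphere 0 1" F e] \<open>e > 0\<close> by auto
  show ?thesis
  proof
    show "trig_poly (\<lambda>y. g (cis y))"
      by (rule trig_poly_polynomial[OF g(1)])
    fix y :: real assume y: "y \<in> {0..2 * pi}"
    have "F (cis y) = u y"
    \<comment> \<open>At 2 pi the argument of \<open>cis y\<close> is 0 and not y, so the end point
      relies on u (2 pi) = u 0.\<close>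
    proof (cases "y = 2 * pi")
      case True
      moreover have "Arg2pi 1 = 0"
        by (rule Arg2pi_unique[of 1]) auto
      ultimately show ?thesis using eq by (simp add: F_def p_def)
    next
      case False
      then have "Arg2pi (cis y) = y"
        using y by (intro Arg2pi_unique[of 1]) (auto simp: cis_conv_exp)
      then show ?thesis by (simp add: F_def p_def)
    qed
    then show "cmod (u y - g (cis y)) < e"
      using g(2)[of "cis y"] by simp
  qed
qed

text \<open>u is orthogonal to all trigonometric polynomials. Approximating the conjugate of u by
  such a T shows that the integral of |u|^2, which equals that of u (cnj u - T), is arbitrarily
  small.\<close>

lemma fourier_unique:
  fixes u :: "real \<Rightarrow> complex"
  assumes u: "continuous_on {0..2 * pi} u" and eq: "u (2 * pi) = u 0"
    and zero: "\<And>n::int. integral {0..2 * pi} (\<lambda>y. u y * cis (of_int n * y)) = 0"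
    and y: "y \<in> {0..2 * pi}"
  shows "u y = 0"
proof -
  have T0: "integral {0..2 * pi} (\<lambda>y. u y * T y) = 0" if "trig_poly T" for T
    using that
  proof induction
    case (trig_poly_monom a n)
    have "integral {0..2 * pi} (\<lambda>y. a * (u y * cis (of_int n * y))) = 0"
      unfolding integral_mult_right zero by simp
    then show ?case by (simp add: algebra_simps)
  next
    case (trig_poly_add S T)
    then show ?case
      by (simp add: distrib_left integral_add integrable_continuous_interval continuous_intros u trig_poly_continuous)
  qed
  define I where "I = integral {0..2 * pi} (\<lambda>y. u y * cnj (u y))"
  obtain M where M: "cmod (u y) \<le> M" if "y \<in> {0..2 * pi}" for y
  proof -
    have "bounded (u ` {0..2 * pi})"
      by (rule compact_imp_bounded[OF compact_continuous_image[OF u]]) simp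
    then obtain M where "\<forall>y\<in>{0..2 * pi}. cmod (u y) \<le> M"
      unfolding bounded_iff by blast
    then show ?thesis
      using that by blast
  qed
  have "M \<ge> 0"
    using M[OF y] norm_ge_zero order_trans by blast
  have "cmod I \<le> M * e * (2 * pi)" if "e > 0" for e
  proof -
    obtain T where T: "trig_poly T" "\<And>y. y \<in> {0..2 * pi} \<Longrightarrow> cmod (cnj (u y) - T y) < e"
      using trig_poly_approx[of "\<lambda>y. cnj (u y)" e] u eq \<open>e > 0\<close> by (auto intro: continuous_intros)
    have "I = integral {0..2 * pi} (\<lambda>y. u y * (cnj (u y) - T y))"
      unfolding right_diff_distrib I_def
      by (subst integral_diff)
         (auto intro!: integrable_continuous_interval continuous_intros u trig_poly_continuous[OF T(1)] simp: T0[OF T(1)])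
    also have "cmod \<dots> \<le> (M * e) * (2 * pi - 0)"
    proof (rule integral_bound)
      fix y :: real assume "y \<in> {0..2 * pi}"
      then show "cmod (u y * (cnj (u y) - T y)) \<le> M * e"
        unfolding norm_mult using M T(2) \<open>M \<ge> 0\<close> by (intro mult_mono) (auto intro: less_imp_le)
    qed (auto intro!: continuous_intros u trig_poly_continuous[OF T(1)])
    finally show ?thesis by simp
  qed
  note le = this
  have "cmod I \<le> 0 + e" if "e > 0" for e
  proof -
    \<comment> \<open>The summand 1 keeps the divisor positive, as M may be 0.\<close>
    have pos: "M * (2 * pi) + 1 > 0"
      using \<open>M \<ge> 0\<close> by (intro add_nonneg_pos) auto
    then have "cmod I \<le> e * (M * (2 * pi) / (M * (2 * pi) + 1))"
      using le[of "e / (M * (2 * pi) + 1)"] \<open>e > 0\<close> by (simp add: mult_ac)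
    also have "\<dots> \<le> e * 1"
      using pos \<open>e > 0\<close> by (intro mult_left_mono) auto
    finally show ?thesis by simp
  qed
  then have "I = 0"
    using field_le_epsilon[of "cmod I" 0] by simp
  moreover have "(\<lambda>y. (cmod (u y))\<^sup>2) integrable_on {0..2 * pi}"
    by (intro integrable_continuous_interval continuous_intros u)
  from integral_linear[OF this bounded_linear_of_real]
  have "I = complex_of_real (integral {0..2 * pi} (\<lambda>y. (cmod (u y))\<^sup>2))"
    unfolding I_def complex_norm_square[symmetric] o_def .
  ultimately have "integral {0..2 * pi} (\<lambda>y. (cmod (u y))\<^sup>2) = 0"
    by simp
  moreover have "continuous_on {0..2 * pi} (\<lambda>y. (cmod (u y))\<^sup>2)"
    by (intro continuous_intros u)
  ultimately have "(cmod (u y))\<^sup>2 = 0"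
    using integral_eq_0_iff[of 0 "2 * pi" "\<lambda>y. (cmod (u y))\<^sup>2"] y by simp
  then show ?thesis by simp
qed

section \<open>Fourier coefficients of antiperiodic functions\<close>

definition fourier_coeff :: "real \<Rightarrow> (real \<Rightarrow> complex) \<Rightarrow> complex" where
  "fourier_coeff k h = integral {0..2 * pi} (\<lambda>y. h y * cis (- (k * y))) / (2 * pi)"

text \<open>The frequencies k for which \<open>cis (k * y)\<close> changes sign under y -> y + 2 pi,
  as kernel spinors do.\<close>

definition half_odd :: "real set" where
  "half_odd = range (\<lambda>n::int. of_int n + 1 / 2)"

text \<open>Multiplication by \<open>cis (- (y / 2))\<close> makes h periodic and shifts half-odd
  frequencies to integers. Vanishing spreads from one period to all y through |h|, which is truly
  periodic.\<close>

lemma fourier_unique_antiperiodic: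
  assumes h: "continuous_on UNIV h" and anti: "\<And>y. h (y + 2 * pi) = - h y"
    and zero: "\<And>k. k \<in> half_odd \<Longrightarrow> fourier_coeff k h = 0"
  shows "h y = 0"
proof -
  define u where "u y = h y * cis (- (y / 2))" for y
  have "u y = 0" if y: "y \<in> {0..2 * pi}" for y
  proof (rule fourier_unique[OF _ _ _ y])
    show "continuous_on {0..2 * pi} u"
      unfolding u_def by (intro continuous_intros continuous_on_subset[OF h]) auto
    show "u (2 * pi) = u 0"
      using anti[of 0] by (simp add: u_def complex_eq_iff)
    fix n :: int
    have "u y * cis (of_int n * y) = h y * cis (- ((of_int (- n) + 1 / 2) * y))" for y
      by (simp add: u_def mult.assoc cis_mult algebra_simps)
    moreover have "real_of_int (- n) + 1 / 2 \<in> half_odd"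
      unfolding half_odd_def by (rule rangeI)
    ultimately show "integral {0..2 * pi} (\<lambda>y. u y * cis (of_int n * y)) = 0"
      using zero unfolding fourier_coeff_def by fastforce
  qed
  then have h0: "h y = 0" if "y \<in> {0..2 * pi}" for y
    using that by (force simp: u_def)
  interpret periodic_fun_simple "\<lambda>y. cmod (h y)" "2 * pi"
    by unfold_locales (simp add: anti)
  define m where "m = \<lfloor>y / (2 * pi)\<rfloor>"
  have "of_int m \<le> y / (2 * pi)" "y / (2 * pi) \<le> of_int m + 1"
    unfolding m_def by linarith+
  then have "h (y - of_int m * (2 * pi)) = 0"
    by (intro h0) (auto simp: field_simps)
  then show ?thesis
    using minus_of_int[of y m] by simp
qed

lemma cis_has_vector_derivative:
  "((\<lambda>y. cis (k * y)) has_vector_derivative \<i> * of_real k * cis (k * y)) (at y within S)"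
proof -
  have "((\<lambda>z. exp (\<i> * of_real k * z)) has_field_derivative
      \<i> * of_real k * exp (\<i> * of_real k * of_real y)) (at (of_real y))"
    by (auto intro!: derivative_eq_intros)
  from has_vector_derivative_real_field[OF this] show ?thesis
    by (simp add: cis_conv_exp mult.assoc)
qed

lemma integral_cis:
  assumes "n \<noteq> 0"
  shows "integral {0..2 * pi} (\<lambda>y. cis (of_int n * y)) = 0"
proof -
  have "((\<lambda>y. cis (of_int n * y) / (\<i> * of_int n)) has_vector_derivative cis (of_int n * y)) (at y within {0..2 * pi})" for y
    using has_vector_derivative_divide[OF cis_has_vector_derivative[of "of_int n" y], of "\<i> * of_int n"] assms
    by simp
  then have "((\<lambda>y. cis (of_int n * y)) has_integral
      cis (of_int n * (2 * pi)) / (\<i> * of_int n) - cis (of_int n * 0) / (\<i> * of_int n)) {0..2 * pi}"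
    by (intro fundamental_theorem_of_calculus) auto
  moreover have "cis (of_int n * (2 * pi)) = 1"
    using cis_multiple_2pi[of n] by (simp add: mult.commute)
  ultimately show ?thesis
    by (simp add: integral_unique)
qed

lemma fourier_coeff_cis:
  assumes "k \<in> half_odd" "l \<in> half_odd"
  shows "fourier_coeff k (\<lambda>y. a * cis (l * y)) = (if k = l then a else 0)"
proof -
  obtain m n :: int where kl: "k = of_int m + 1 / 2" "l = of_int n + 1 / 2"
    using assms by (auto simp: half_odd_def)
  have eq: "a * cis (l * y) * cis (- (k * y)) = a * cis (of_int (n - m) * y)" for y
    by (simp add: kl mult.assoc cis_mult algebra_simps)
  have "fourier_coeff k (\<lambda>y. a * cis (l * y)) = a * integral {0..2 * pi} (\<lambda>y. cis (of_int (n - m) * y)) / (2 * pi)"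
    unfolding fourier_coeff_def eq by simp
  then show ?thesis
    using integral_cis[of "n - m"] by (auto simp: kl scaleR_conv_of_real)
qed

section \<open>Fourier modes of kernel spinors\<close>

lemma fourier_coeff_add:
  assumes "continuous_on UNIV h" "continuous_on UNIV h'"
  shows "fourier_coeff k (\<lambda>y. h y + h' y) = fourier_coeff k h + fourier_coeff k h'"
proof -
  have "continuous_on {0..2 * pi} h" "continuous_on {0..2 * pi} h'"
    using assms continuous_on_subset by blast+
  then have "integral {0..2 * pi} (\<lambda>y. h y * cis (- (k * y)) + h' y * cis (- (k * y))) =
      integral {0..2 * pi} (\<lambda>y. h y * cis (- (k * y))) + integral {0..2 * pi} (\<lambda>y. h' y * cis (- (k * y)))"
    by (intro integral_add integrable_continuous_interval continuous_intros)
  then show ?thesis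
    by (simp add: fourier_coeff_def distrib_right add_divide_distrib)
qed

lemma fourier_coeff_mult: "fourier_coeff k (\<lambda>y. c * h y) = c * fourier_coeff k h"
  by (simp add: fourier_coeff_def mult.assoc)

lemma fourier_coeff_sum:
  assumes "finite S" "\<And>s. s \<in> S \<Longrightarrow> continuous_on UNIV (h s)"
  shows "fourier_coeff k (\<lambda>y. \<Sum>s\<in>S. h s y) = (\<Sum>s\<in>S. fourier_coeff k (h s))"
  using assms
proof induction
  case empty
  show ?case by (simp add: fourier_coeff_def)
next
  case (insert s S)
  then show ?case by (simp add: fourier_coeff_add continuous_on_sum)
qed

lemma fourier_coeff_le:
  assumes h: "continuous_on UNIV h" and M: "\<And>y. cmod (h y) \<le> M"
  shows "cmod (fourier_coeff k h) \<le> M"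
proof -
  have "cmod (integral {0..2 * pi} (\<lambda>y. h y * cis (- (k * y)))) \<le> M * (2 * pi - 0)"
    by (rule integral_bound) (auto intro!: continuous_intros continuous_on_subset[OF h] simp: norm_mult M)
  then show ?thesis
    by (simp add: fourier_coeff_def norm_divide norm_mult field_simps)
qed

lemma fourier_coeff_continuous:
  fixes h :: "real \<times> real \<Rightarrow> complex"
  assumes "continuous_on UNIV h"
  shows "continuous_on UNIV (\<lambda>x. fourier_coeff k (\<lambda>y. h (x, y)))"
proof -
  have "continuous_on UNIV (\<lambda>x. integral (cbox 0 (2 * pi)) (\<lambda>y. h (x, y) * cis (- (k * y))))"
    by (rule integral_continuous_on_param)
       (auto intro!: continuous_intros continuous_on_compose2[OF assms] simp: case_prod_unfold)
  then show ?thesis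
    unfolding fourier_coeff_def by (auto intro!: continuous_intros)
qed

lemma fourier_coeff_deriv_param:
  fixes h h' :: "real \<times> real \<Rightarrow> complex"
  assumes h: "continuous_on UNIV h" and h': "continuous_on UNIV h'"
    and d: "\<And>x y. ((\<lambda>t. h (t, y)) has_vector_derivative h' (x, y)) (at x)"
  shows "((\<lambda>x. fourier_coeff k (\<lambda>y. h (x, y))) has_vector_derivative
    fourier_coeff k (\<lambda>y. h' (x, y))) (at x)"
proof -
  have "((\<lambda>x. integral (cbox 0 (2 * pi)) (\<lambda>y. h (x, y) * cis (- (k * y)))) has_vector_derivative
      integral (cbox 0 (2 * pi)) (\<lambda>y. h' (x, y) * cis (- (k * y)))) (at x within UNIV)"
  proof (rule leibniz_rule_vector_derivative)
    show "((\<lambda>x. h (x, t) * cis (- (k * t))) has_vector_derivative h' (x, t) * cis (- (k * t))) (at x within UNIV)" for x t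
      by (intro has_vector_derivative_mult_left d)
    show "(\<lambda>y. h (x, y) * cis (- (k * y))) integrable_on cbox 0 (2 * pi)" for x
      by (intro integrable_continuous continuous_intros continuous_on_compose2[OF h]) auto
    show "continuous_on (UNIV \<times> cbox 0 (2 * pi)) (\<lambda>(x, t). h' (x, t) * cis (- (k * t)))"
      by (auto intro!: continuous_intros continuous_on_compose2[OF h'] simp: case_prod_unfold)
  qed auto
  then show ?thesis
    unfolding fourier_coeff_def cbox_interval by (intro has_vector_derivative_divide) simp
qed

text \<open>Integration by parts: for half-odd k the factor \<open>cis (- (k * (2 * pi)))\<close> is
  - 1 and cancels the sign change of h, so no boundary term remains.\<close>

lemma fourier_coeff_deriv:
  assumes k: "k \<in> half_odd" and d: "\<And>y. (h has_vector_derivative h' y) (at y)"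
    and h': "continuous_on UNIV h'" and anti: "h (2 * pi) = - h 0"
  shows "fourier_coeff k h' = \<i> * of_real k * fourier_coeff k h"
proof -
  obtain n :: int where n: "k = of_int n + 1 / 2"
    using k by (auto simp: half_odd_def)
  have h: "continuous_on UNIV h"
    using d by (intro continuous_at_imp_continuous_on ballI) (metis has_vector_derivative_continuous)
  have cis': "((\<lambda>y. cis (- (k * y))) has_vector_derivative - \<i> * of_real k * cis (- (k * y))) (at y)" for y
    using cis_has_vector_derivative[of "- k" y] by simp
  have "((\<lambda>y. h' y * cis (- (k * y)) - \<i> * of_real k * (h y * cis (- (k * y)))) has_integral
      h (2 * pi) * cis (- (k * (2 * pi))) - h 0 * cis (- (k * 0))) {0..2 * pi}"
  proof (rule fundamental_theorem_of_calculus)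
    fix y :: real
    show "((\<lambda>y. h y * cis (- (k * y))) has_vector_derivative
        h' y * cis (- (k * y)) - \<i> * of_real k * (h y * cis (- (k * y)))) (at y within {0..2 * pi})"
      by (rule has_vector_derivative_eq_rhs[OF has_vector_derivative_mult
            [OF has_vector_derivative_at_within[OF d] has_vector_derivative_at_within[OF cis']]])
         (simp add: algebra_simps)
  qed simp
  moreover have "cis (- (k * (2 * pi))) = - 1"
  proof -
    have "cis (- (k * (2 * pi))) = cis (2 * pi * of_int (- n)) * cis (- pi)"
      unfolding cis_mult by (simp add: n algebra_simps)
    also have "cis (2 * pi * of_int (- n)) = 1"
      by (rule cis_multiple_2pi) simp
    finally show ?thesis by (simp add: complex_eq_iff)
  qed
  ultimately have "integral {0..2 * pi} (\<lambda>y. h' y * cis (- (k * y)) - \<i> * of_real k * (h y * cis (- (k * y)))) = 0"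
    using anti by (simp add: integral_unique)
  moreover have "integral {0..2 * pi} (\<lambda>y. h' y * cis (- (k * y)) - \<i> * of_real k * (h y * cis (- (k * y))))
      = integral {0..2 * pi} (\<lambda>y. h' y * cis (- (k * y)))
        - integral {0..2 * pi} (\<lambda>y. \<i> * of_real k * (h y * cis (- (k * y))))"
    by (intro integral_diff integrable_continuous_interval continuous_intros
        continuous_on_subset[OF h] continuous_on_subset[OF h']) auto
  ultimately show ?thesis
    by (simp add: fourier_coeff_def)
qed

text \<open>Solving the Dirac equation for \<open>partial_x\<close> turns it into an evolution in x,
  which separates into ODEs for the Fourier modes in y.\<close>

lemma dirac_kernelD:
  assumes "\<psi> \<in> dirac_kernel U"
  shows "\<And>p. \<psi> differentiable (at p)" "continuous_on UNIV \<psi>"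
    "continuous_on UNIV (partial_x \<psi>)" "continuous_on UNIV (partial_y \<psi>)"
    "\<And>x y. \<psi> (x, y + 2 * pi) = - \<psi> (x, y)"
    "\<And>p. partial_x \<psi> p $ 2 = \<i> * partial_y \<psi> p $ 2 - 2 * of_real (U (fst p)) * \<psi> p $ 1"
    "\<And>p. partial_x \<psi> p $ 1 = - \<i> * partial_y \<psi> p $ 1 + 2 * of_real (U (fst p)) * \<psi> p $ 2"
proof -
  show d: "\<psi> differentiable (at p)" for p
    using assms unfolding dirac_kernel_def C1_spinor_def by blast
  then show "continuous_on UNIV \<psi>"
    using differentiable_imp_continuous_within by (blast intro: continuous_at_imp_continuous_on)
  have "dirac U \<psi> p = 0" for p
    using assms unfolding dirac_kernel_def by blast
  from this[unfolded dirac_eq_0_iff[OF d]]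
  show "partial_x \<psi> p $ 2 = \<i> * partial_y \<psi> p $ 2 - 2 * of_real (U (fst p)) * \<psi> p $ 1"
    "partial_x \<psi> p $ 1 = - \<i> * partial_y \<psi> p $ 1 + 2 * of_real (U (fst p)) * \<psi> p $ 2" for p
    by (simp_all add: field_simps)
qed (use assms in \<open>auto simp: dirac_kernel_def C1_spinor_def\<close>)

definition mode :: "spinor \<Rightarrow> real \<Rightarrow> 2 \<Rightarrow> real \<Rightarrow> complex" where
  "mode \<psi> k i x = fourier_coeff k (\<lambda>y. \<psi> (x, y) $ i)"

text \<open>Differentiation under the integral sign. Continuity of the derivative is recorded
  because \<open>continuous_potential\<close> recovers U from it.\<close>

lemma mode_deriv:
  assumes \<psi>: "\<psi> \<in> dirac_kernel U"
  shows "(mode \<psi> k i has_vector_derivative mode (partial_x \<psi>) k i x) (at x)"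
    and "continuous_on UNIV (mode (partial_x \<psi>) k i)"
proof -
  note D = dirac_kernelD[OF \<psi>]
  show "(mode \<psi> k i has_vector_derivative mode (partial_x \<psi>) k i x) (at x)"
    unfolding mode_def
  proof (rule fourier_coeff_deriv_param)
    show "((\<lambda>t. \<psi> (t, y) $ i) has_vector_derivative partial_x \<psi> (x, y) $ i) (at x)" for x y
      using bounded_linear.has_vector_derivative[OF bounded_linear_vec_nth has_partials(1)[OF D(1)[of "(x, y)"]]]
      by simp
  qed (auto intro!: continuous_intros D)
  show "continuous_on UNIV (mode (partial_x \<psi>) k i)"
    unfolding mode_def by (intro fourier_coeff_continuous continuous_intros D)
qed

lemma mode_zs_solution:
  assumes \<psi>: "\<psi> \<in> dirac_kernel U" and k: "k \<in> half_odd"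
  shows "zs_solution (\<lambda>x. 2 * U x) k (mode \<psi> k 1) (mode \<psi> k 2)"
proof -
  note D = dirac_kernelD[OF \<psi>]
  have slice: "continuous_on UNIV (\<lambda>y. f (x, y) $ i)" if "continuous_on UNIV f" for f :: spinor and x i
    by (intro continuous_intros continuous_on_compose2[OF that]) auto
  have py: "mode (partial_y \<psi>) k i x = \<i> * of_real k * mode \<psi> k i x" for i x
    unfolding mode_def
  proof (rule fourier_coeff_deriv[OF k])
    show "((\<lambda>y. \<psi> (x, y) $ i) has_vector_derivative partial_y \<psi> (x, y) $ i) (at y)" for y
      using bounded_linear.has_vector_derivative[OF bounded_linear_vec_nth has_partials(2)[OF D(1)[of "(x, y)"]]]
      by simp
    show "\<psi> (x, 2 * pi) $ i = - \<psi> (x, 0) $ i"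
      using D(5)[of x 0] by simp
  qed (intro slice D)
  have "mode (partial_x \<psi>) k 1 x = - \<i> * mode (partial_y \<psi>) k 1 x + 2 * of_real (U x) * mode \<psi> k 2 x" for x
    unfolding mode_def D(7) fst_conv
    by (subst fourier_coeff_add) (auto simp: fourier_coeff_mult mult.assoc[of 2] fourier_coeff_mult[of _ "- \<i>", simplified] intro!: continuous_intros slice D)
  moreover have "mode (partial_x \<psi>) k 2 x = \<i> * mode (partial_y \<psi>) k 2 x + (- 2 * of_real (U x)) * mode \<psi> k 1 x" for x
  proof -
    have "partial_x \<psi> (x, y) $ 2 = \<i> * partial_y \<psi> (x, y) $ 2 + (- 2 * of_real (U x)) * \<psi> (x, y) $ 1" for y
      by (simp add: D(6))
    then show ?thesis
      unfolding mode_def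
      by (simp only: fourier_coeff_mult fourier_coeff_add slice D continuous_on_mult_left)
  qed
  ultimately have "k *\<^sub>R mode \<psi> k 1 x + (2 * U x) *\<^sub>R mode \<psi> k 2 x = mode (partial_x \<psi>) k 1 x"
    "- (k *\<^sub>R mode \<psi> k 2 x) - (2 * U x) *\<^sub>R mode \<psi> k 1 x = mode (partial_x \<psi>) k 2 x" for x
    by (simp_all add: py scaleR_conv_of_real flip: mult.assoc)
  then show ?thesis
    by (simp add: zs_solution_def mode_deriv(1)[OF \<psi>])
qed

lemma mode_tendsto:
  assumes \<psi>: "\<psi> \<in> dirac_kernel U"
  shows "(mode \<psi> k i \<longlongrightarrow> 0) at_infinity"
proof -
  note D = dirac_kernelD[OF \<psi>]
  obtain C where C: "\<forall>\<^sub>F x in at_infinity. \<forall>y. (norm (\<psi> (x, y)))\<^sup>2 \<le> C * exp (- \<bar>x\<bar>)"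
    using \<psi> by (auto simp: dirac_kernel_def)
  show ?thesis
  proof (rule Lim_null_comparison)
    show "\<forall>\<^sub>F x in at_infinity. norm (mode \<psi> k i x) \<le> sqrt (C * exp (- \<bar>x\<bar>))"
      using C
    proof eventually_elim
      case (elim x)
      have "norm (\<psi> (x, y) $ i) \<le> sqrt (C * exp (- \<bar>x\<bar>))" for y
        using elim[rule_format, of y] Finite_Cartesian_Product.norm_nth_le[of "\<psi> (x, y)" i] by (meson order_trans real_le_rsqrt)
      then show ?case
        unfolding mode_def
        by (intro fourier_coeff_le continuous_intros continuous_on_compose2[OF D(2)]) auto
    qed
    have "((\<lambda>x::real. exp (- \<bar>x\<bar>)) \<longlongrightarrow> 0) at_infinity"
      using filterlim_compose[OF exp_at_bot filterlim_compose[OF filterlim_uminus_at_bot_at_top filterlim_norm_at_top[where 'a = real]]]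
      by simp
    then have "((\<lambda>x::real. sqrt (C * exp (- \<bar>x\<bar>))) \<longlongrightarrow> sqrt (C * 0)) at_infinity"
      by (intro tendsto_intros)
    then show "((\<lambda>x::real. sqrt (C * exp (- \<bar>x\<bar>))) \<longlongrightarrow> 0) at_infinity"
      by simp
  qed
qed

section \<open>The spectrum and the upper bound for the dimension of the kernel\<close>

definition spectrum :: "(real \<Rightarrow> real) \<Rightarrow> real set" where
  "spectrum U = {k \<in> half_odd. \<exists>f g. bound_state (\<lambda>x. 2 * U x) k f g}"

lemma mode_Re_Im:
  assumes \<psi>: "\<psi> \<in> dirac_kernel U" and k: "k \<in> half_odd" and L: "bounded_linear (L :: complex \<Rightarrow> real)"
  shows "zs_solution (\<lambda>x. 2 * U x) k (\<lambda>x. L (mode \<psi> k 1 x)) (\<lambda>x. L (mode \<psi> k 2 x))"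
    and "((\<lambda>x. L (mode \<psi> k i x)) \<longlongrightarrow> 0) at_infinity"
  using zs_solution_bounded_linear[OF mode_zs_solution[OF \<psi> k] L]
    bounded_linear.tendsto_zero[OF L mode_tendsto[OF \<psi>]] by auto

text \<open>L is the real or the imaginary part, whichever is nonzero at x. Consequently modes
  outside \<open>spectrum U\<close> vanish.\<close>

lemma mode_bound_state:
  assumes \<psi>: "\<psi> \<in> dirac_kernel U" and k: "k \<in> half_odd" and nz: "mode \<psi> k i x \<noteq> 0"
  obtains L :: "complex \<Rightarrow> real" where "bounded_linear L"
    "bound_state (\<lambda>x. 2 * U x) k (\<lambda>x. L (mode \<psi> k 1 x)) (\<lambda>x. L (mode \<psi> k 2 x))"
proof -
  have "Re (mode \<psi> k i x) \<noteq> 0 \<or> Im (mode \<psi> k i x) \<noteq> 0"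
    using nz by (simp add: complex_eq_iff)
  then obtain L :: "complex \<Rightarrow> real" where L: "bounded_linear L" "L (mode \<psi> k i x) \<noteq> 0"
    using bounded_linear_Re bounded_linear_Im by blast
  have "i = 1 \<or> i = 2"
    by (rule exhaust_2)
  with L have "bound_state (\<lambda>x. 2 * U x) k (\<lambda>x. L (mode \<psi> k 1 x)) (\<lambda>x. L (mode \<psi> k 2 x))"
    using mode_Re_Im[OF \<psi> k L(1)] unfolding bound_state_def by blast
  with L(1) that show ?thesis
    by blast
qed

lemma mode_eq_multiple:
  assumes \<psi>: "\<psi> \<in> dirac_kernel U" and k: "k \<in> half_odd"
    and bs: "bound_state (\<lambda>x. 2 * U x) k f g"
  obtains c where "\<And>x. mode \<psi> k 1 x = c * of_real (f x)" "\<And>x. mode \<psi> k 2 x = c * of_real (g x)"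
proof -
  note zs = mode_Re_Im[OF \<psi> k]
  obtain a where a: "(\<lambda>x. Re (mode \<psi> k 1 x)) = (\<lambda>x. a * f x)" "(\<lambda>x. Re (mode \<psi> k 2 x)) = (\<lambda>x. a * g x)"
    using bound_state_unique[OF bs zs(1) zs(2) zs(2), OF bounded_linear_Re bounded_linear_Re bounded_linear_Re] .
  obtain b where b: "(\<lambda>x. Im (mode \<psi> k 1 x)) = (\<lambda>x. b * f x)" "(\<lambda>x. Im (mode \<psi> k 2 x)) = (\<lambda>x. b * g x)"
    using bound_state_unique[OF bs zs(1) zs(2) zs(2), OF bounded_linear_Im bounded_linear_Im bounded_linear_Im] .
  show ?thesis
    by (rule that[of "Complex a b"]) (use a b in \<open>simp_all add: complex_eq_iff fun_eq_iff\<close>)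
qed

definition mode_spinor :: "real \<Rightarrow> (real \<Rightarrow> real) \<Rightarrow> (real \<Rightarrow> real) \<Rightarrow> spinor" where
  "mode_spinor k f g p = vector [of_real (f (fst p)) * cis (k * snd p), of_real (g (fst p)) * cis (k * snd p)]"

lemma mode_spinor_nth:
  "mode_spinor k f g p $ i = of_real (if i = 1 then f (fst p) else g (fst p)) * cis (k * snd p)"
  using exhaust_2[of i] by (auto simp: mode_spinor_def)

lemma cis_half_odd:
  assumes "k \<in> half_odd"
  shows "cis (k * (y + 2 * pi)) = - cis (k * y)"
proof -
  obtain n :: int where n: "k = of_int n + 1 / 2"
    using assms by (auto simp: half_odd_def)
  have "cis (k * (y + 2 * pi)) = cis (k * y) * cis (2 * pi * of_int n) * cis pi"
    unfolding cis_mult by (simp add: n algebra_simps)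
  also have "cis (2 * pi * of_int n) = 1"
    by (rule cis_multiple_2pi) simp
  finally show ?thesis by simp
qed

text \<open>Modes outside the spectrum vanish and those inside are multiples of the chosen bound
  states. Subtracting the finite sum of these leaves, for each x, a function of y with all
  coefficients 0; no convergence of Fourier series is involved.\<close>

lemma dirac_kernel_subset_span:
  assumes fin: "finite (spectrum U)"
    and bs: "\<And>k. k \<in> spectrum U \<Longrightarrow> bound_state (\<lambda>x. 2 * U x) k (F k) (G k)"
  shows "dirac_kernel U \<subseteq> spinor.span ((\<lambda>k. mode_spinor k (F k) (G k)) ` spectrum U)"
proof
  fix \<psi> assume \<psi>: "\<psi> \<in> dirac_kernel U"
  note D = dirac_kernelD[OF \<psi>]
  define M where "M k = mode_spinor k (F k) (G k)" for k
  have odd: "k \<in> half_odd" if "k \<in> spectrum U" for k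
    using that by (simp add: spectrum_def)
  have "\<exists>c. \<forall>x. mode \<psi> k 1 x = c * of_real (F k x) \<and> mode \<psi> k 2 x = c * of_real (G k x)"
    if "k \<in> spectrum U" for k
    using mode_eq_multiple[OF \<psi> odd[OF that] bs[OF that]] by metis
  then obtain c where c: "mode \<psi> k 1 x = c k * of_real (F k x)" "mode \<psi> k 2 x = c k * of_real (G k x)"
    if "k \<in> spectrum U" for k x
    by metis
  define a where "a k i x = c k * of_real (if i = (1::2) then F k x else G k x)" for k i x
  have mode_a: "mode \<psi> k i x = a k i x" if "k \<in> spectrum U" for k i x
    using c[OF that] exhaust_2[of i] by (auto simp: a_def)
  have mode_0: "mode \<psi> k i x = 0" if "k \<in> half_odd" "k \<notin> spectrum U" for k i x
    using mode_bound_state[OF \<psi> that(1)] that unfolding spectrum_def by blast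
  have "\<psi> (x, y) $ i + (\<Sum>k\<in>spectrum U. - a k i x * cis (k * y)) = 0" for x y i
  proof (rule fourier_unique_antiperiodic[where h = "\<lambda>y. \<psi> (x, y) $ i + (\<Sum>k\<in>spectrum U. - a k i x * cis (k * y))"])
    have 1: "continuous_on UNIV (\<lambda>y. \<psi> (x, y) $ i)"
      by (intro continuous_intros continuous_on_compose2[OF D(2)]) auto
    have 2: "continuous_on UNIV (\<lambda>y. \<Sum>k\<in>spectrum U. - a k i x * cis (k * y))"
      by (intro continuous_intros)
    show "continuous_on UNIV (\<lambda>y. \<psi> (x, y) $ i + (\<Sum>k\<in>spectrum U. - a k i x * cis (k * y)))"
      by (rule continuous_on_add[OF 1 2])
    show "\<psi> (x, y + 2 * pi) $ i + (\<Sum>k\<in>spectrum U. - a k i x * cis (k * (y + 2 * pi))) =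
        - (\<psi> (x, y) $ i + (\<Sum>k\<in>spectrum U. - a k i x * cis (k * y)))" for y
      using odd by (simp add: D(5) cis_half_odd sum_negf)
    fix l assume l: "l \<in> half_odd"
    have "fourier_coeff l (\<lambda>y. \<psi> (x, y) $ i + (\<Sum>k\<in>spectrum U. - a k i x * cis (k * y)))
        = mode \<psi> l i x + (\<Sum>k\<in>spectrum U. fourier_coeff l (\<lambda>y. - a k i x * cis (k * y)))"
      unfolding fourier_coeff_add[OF 1 2] mode_def
      by (subst fourier_coeff_sum[OF fin]) (auto intro!: continuous_intros)
    also have "(\<Sum>k\<in>spectrum U. fourier_coeff l (\<lambda>y. - a k i x * cis (k * y))) =
        (\<Sum>k\<in>spectrum U. if l = k then - a k i x else 0)"
      by (intro sum.cong refl fourier_coeff_cis[OF l odd])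
    also have "\<dots> = (if l \<in> spectrum U then - a l i x else 0)"
      using fin by simp
    also have "mode \<psi> l i x + \<dots> = 0"
      using mode_a mode_0 l by auto
    finally show "fourier_coeff l (\<lambda>y. \<psi> (x, y) $ i + (\<Sum>k\<in>spectrum U. - a k i x * cis (k * y))) = 0" .
  qed
  then have eq: "\<psi> (x, y) $ i = (\<Sum>k\<in>spectrum U. a k i x * cis (k * y))" for x y i
    by (simp add: sum_negf eq_neg_iff_add_eq_0)
  have sum_nth: "(\<Sum>k\<in>S. spinor_scale (c k) (M k)) p $ i = (\<Sum>k\<in>S. (c k * M k p $ i))" for p i S
    by (induction S rule: infinite_finite_induct) (auto simp: spinor_scale_def)
  have "\<psi> p $ i = (\<Sum>k\<in>spectrum U. spinor_scale (c k) (M k)) p $ i" for p i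
    unfolding sum_nth by (cases p) (simp only: eq a_def M_def mode_spinor_nth mult.assoc fst_conv snd_conv)
  then have "\<psi> = (\<Sum>k\<in>spectrum U. spinor_scale (c k) (M k))"
    by (simp add: fun_eq_iff vec_eq_iff)
  moreover have "(\<Sum>k\<in>spectrum U. spinor_scale (c k) (M k)) \<in> spinor.span (M ` spectrum U)"
    by (intro spinor.span_sum spinor.span_scale spinor.span_base) auto
  ultimately show "\<psi> \<in> spinor.span ((\<lambda>k. mode_spinor k (F k) (G k)) ` spectrum U)"
    unfolding M_def by simp
qed

lemma half_odd_uminus:
  assumes "k \<in> half_odd"
  shows "- k \<in> half_odd"
proof -
  obtain n :: int where "k = of_int n + 1 / 2"
    using assms by (auto simp: half_odd_def)
  then have "- k = of_int (- n - 1) + 1 / 2"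
    by simp
  then show ?thesis
    unfolding half_odd_def by blast
qed

lemma spectrum_uminus: "k \<in> spectrum U \<Longrightarrow> - k \<in> spectrum U"
  using half_odd_uminus bound_state_swap unfolding spectrum_def by blast

lemma half_odd_nonzero: "0 \<notin> half_odd"
proof
  assume "0 \<in> half_odd"
  then obtain n :: int where "0 = of_int n + (1 / 2 :: real)"
    by (auto simp: half_odd_def)
  then have "of_int (2 * n + 1) = (0 :: real)"
    by simp
  then have "2 * n + 1 = 0"
    by (subst (asm) of_int_eq_0_iff)
  then show False by presburger
qed

lemma half_odd_posD:
  assumes "k \<in> half_odd" "k > 0"
  obtains m :: nat where "k = real m + 1 / 2"
proof -
  obtain n :: int where n: "k = of_int n + 1 / 2"
    using assms by (auto simp: half_odd_def)
  then have "of_int n > (- 1 :: real)"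
    using assms by simp
  then have "n \<ge> 0" by linarith
  then show ?thesis
    using n by (intro that[of "nat n"]) simp
qed

lemma spectrum_eq_pos_part:
  "spectrum U = (spectrum U \<inter> {0<..}) \<union> uminus ` (spectrum U \<inter> {0<..})" (is "?l = ?r")
proof
  show "?l \<subseteq> ?r"
  proof
    fix k assume k: "k \<in> spectrum U"
    then have "k \<noteq> 0"
      using half_odd_nonzero by (auto simp: spectrum_def)
    then show "k \<in> ?r"
      using k spectrum_uminus[OF k] by (cases "k > 0") (auto intro!: image_eqI[of _ _ "- k"])
  qed
qed (auto intro: spectrum_uminus)

text \<open>If the largest element is m + 1/2, at most m positive half-odd numbers lie below it. It
  is therefore at least n + 1/2 with n the number of the others, and n^2 / 2 + n + 1/2 = (n + 1)^2 /
  2.\<close>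

lemma sum_half_odd_ge:
  assumes "finite K" "K \<subseteq> half_odd \<inter> {0<..}"
  shows "(real (card K))\<^sup>2 / 2 \<le> \<Sum>K"
  using assms
proof (induction K rule: finite_linorder_max_induct)
  case (insert b K)
  obtain m where m: "b = real m + 1 / 2"
    using insert.prems half_odd_posD[of b] by auto
  have "K \<subseteq> (\<lambda>i. real i + 1 / 2) ` {..<m}"
  proof
    fix k assume "k \<in> K"
    then obtain j where "k = real j + 1 / 2"
      using insert.prems half_odd_posD[of k] by auto
    then show "k \<in> (\<lambda>i. real i + 1 / 2) ` {..<m}"
      using insert.hyps(2)[rule_format, OF \<open>k \<in> K\<close>] m by auto
  qed
  then have "card K \<le> card {..<m}"
    by (rule surj_card_le[OF finite_lessThan])
  then have "real (card K) + 1 / 2 \<le> b"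
    using m by simp
  moreover have "b \<notin> K"
    using insert.hyps(2) by auto
  ultimately show ?case
    using insert by (simp add: power2_eq_square algebra_simps)
qed simp

text \<open>Positive half-odd numbers are at least 1/2, so the bound on their sum limits the size of
  every finite set of frequencies and the spectrum is finite. The finite spanning set is part of the
  conclusion because the bound on \<open>spinor.dim\<close> alone would also hold, by the default 0,
  for an infinite-dimensional kernel.\<close>

lemma dim_dirac_kernel_le:
  assumes Q: "\<And>x. (Q has_real_derivative (2 * U x)\<^sup>2) (at x)" "\<And>x. A \<le> Q x" "\<And>x. Q x \<le> B"
  obtains K where "finite K" "K \<subseteq> half_odd \<inter> {0<..}" "4 * \<Sum>K \<le> B - A"
    "spinor.dim (dirac_kernel U) \<le> 2 * card K"
    "\<exists>S. finite S \<and> dirac_kernel U \<subseteq> spinor.span S"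
proof
  define K where "K = spectrum U \<inter> {0<..}"
  have sum_le: "4 * \<Sum>S \<le> B - A" if "finite S" "S \<subseteq> K" for S
    by (rule sum_bound_states_le[OF that(1) _ Q]) (use that(2) in \<open>auto simp: K_def spectrum_def\<close>)
  have K: "K \<subseteq> half_odd \<inter> {0<..}"
    by (auto simp: K_def spectrum_def)
  have "finite K \<and> card K \<le> nat \<lceil>B - A\<rceil>"
  proof (rule finite_if_finite_subsets_card_bdd)
    fix S assume S: "S \<subseteq> K" "finite S"
    have "real (card S) \<le> 4 * (1 / 2 * real (card S))" by simp
    also have "1 / 2 * real (card S) \<le> \<Sum>S"
    proof -
      have "(1 / 2) \<le> k" if k: "k \<in> S" for k
      proof -
        have "k \<in> half_odd" "k > 0"
          using k S K by auto
        then show ?thesis by (rule half_odd_posD) simp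
      qed
      then show ?thesis
        using sum_bounded_below[of S "1 / 2" "\<lambda>k. k"] by (simp add: mult.commute)
    qed
    finally have "real (card S) \<le> B - A"
      using sum_le[OF S(2,1)] by simp
    then show "card S \<le> nat \<lceil>B - A\<rceil>"
      by linarith
  qed
  then show fin: "finite K" by blast
  show "K \<subseteq> half_odd \<inter> {0<..}" by fact
  show "4 * \<Sum>K \<le> B - A"
    by (rule sum_le[OF fin order_refl])
  have fin_spec: "finite (spectrum U)"
    by (subst spectrum_eq_pos_part) (use fin in \<open>simp add: K_def\<close>)
  have "\<exists>f g. bound_state (\<lambda>x. 2 * U x) k f g" if "k \<in> spectrum U" for k
    using that by (simp add: spectrum_def)
  then obtain F G where FG: "bound_state (\<lambda>x. 2 * U x) k (F k) (G k)" if "k \<in> spectrum U" for k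
    by metis
  define S where "S = (\<lambda>k. mode_spinor k (F k) (G k)) ` spectrum U"
  have span: "dirac_kernel U \<subseteq> spinor.span S"
    unfolding S_def by (rule dirac_kernel_subset_span[OF fin_spec FG])
  have "finite S"
    using fin_spec by (simp add: S_def)
  show "\<exists>S. finite S \<and> dirac_kernel U \<subseteq> spinor.span S"
    using \<open>finite S\<close> span by blast
  have "spinor.dim (dirac_kernel U) \<le> card S"
    by (rule spinor.dim_le_card[OF span \<open>finite S\<close>])
  also have "\<dots> \<le> card (spectrum U)"
    unfolding S_def by (rule card_image_le[OF fin_spec])
  also have "\<dots> \<le> card K + card (uminus ` K)"
    using spectrum_eq_pos_part card_Un_le unfolding K_def by metis
  also have "\<dots> \<le> 2 * card K"
    using card_image_le[OF fin, of uminus] by simp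
  finally show "spinor.dim (dirac_kernel U) \<le> 2 * card K" .
qed

text \<open>For a nonzero real mode, f' g - g' f = 2 k f g + 2 U (f^2 + g^2) can be solved for U,
  since f^2 + g^2 never vanishes.\<close>

lemma continuous_potential:
  assumes \<psi>: "\<psi> \<in> dirac_kernel U" "\<psi> \<noteq> 0"
  shows "continuous_on UNIV U"
proof -
  note D = dirac_kernelD[OF \<psi>(1)]
  obtain x0 y0 i0 where "\<psi> (x0, y0) $ i0 \<noteq> 0"
    using \<psi>(2) by (auto simp: fun_eq_iff vec_eq_iff)
  moreover have "continuous_on UNIV (\<lambda>y. \<psi> (x0, y) $ i0)"
    by (intro continuous_intros continuous_on_compose2[OF D(2)]) auto
  ultimately obtain k where k: "k \<in> half_odd" "mode \<psi> k i0 x0 \<noteq> 0"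
    using fourier_unique_antiperiodic[of "\<lambda>y. \<psi> (x0, y) $ i0" y0] D(5) unfolding mode_def by auto
  obtain L :: "complex \<Rightarrow> real" where L: "bounded_linear L"
    and bs: "bound_state (\<lambda>x. 2 * U x) k (\<lambda>x. L (mode \<psi> k 1 x)) (\<lambda>x. L (mode \<psi> k 2 x))"
    using mode_bound_state[OF \<psi>(1) k] .
  define f g f' g' where "f x = L (mode \<psi> k 1 x)" and "g x = L (mode \<psi> k 2 x)"
    and "f' x = L (mode (partial_x \<psi>) k 1 x)" and "g' x = L (mode (partial_x \<psi>) k 2 x)" for x
  have d: "(f has_real_derivative f' x) (at x)" "(g has_real_derivative g' x) (at x)" for x
    unfolding f_def g_def f'_def g'_def has_real_derivative_iff_has_vector_derivative
    by (intro bounded_linear.has_vector_derivative[OF L] mode_deriv[OF \<psi>(1)])+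
  have cont': "continuous_on UNIV f'" "continuous_on UNIV g'"
    unfolding f'_def g'_def
    by (intro bounded_linear.continuous_on[OF L] mode_deriv(2)[OF \<psi>(1)])+
  have cont: "continuous_on UNIV f" "continuous_on UNIV g"
    using d by (auto intro!: continuous_at_imp_continuous_on DERIV_isCont)
  note bs = bs[folded f_def g_def]
  note nz = bound_state_nonzero[OF bs]
  have zs: "zs_solution (\<lambda>x. 2 * U x) k f g"
    using bs by (simp add: bound_state_def)
  have nz': "2 * ((f x)\<^sup>2 + (g x)\<^sup>2) \<noteq> 0" for x
    using nz[of x] by (metis mult_eq_0_iff zero_neq_numeral)
  have "U x = (f' x * g x - g' x * f x - 2 * k * f x * g x) / (2 * ((f x)\<^sup>2 + (g x)\<^sup>2))" for x
  proof (rule eq_divide_imp[OF nz'])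
    have "f' x = k * f x + 2 * U x * g x" "g' x = - (k * g x) - 2 * U x * f x"
      using DERIV_unique[OF d(1) zs_solution_realD(1)[OF zs]] DERIV_unique[OF d(2) zs_solution_realD(2)[OF zs]] by auto
    then show "U x * (2 * ((f x)\<^sup>2 + (g x)\<^sup>2)) = f' x * g x - g' x * f x - 2 * k * f x * g x"
      by algebra
  qed
  then have U_eq: "U = (\<lambda>x. (f' x * g x - g' x * f x - 2 * k * f x * g x) / (2 * ((f x)\<^sup>2 + (g x)\<^sup>2)))"
    by (rule ext)
  show ?thesis
    unfolding U_eq by (intro continuous_intros cont cont' ballI nz')
qed

section \<open>The extremal potential\<close>

lemma inverse_cosh_le: "1 / cosh (x::real) \<le> 2 * exp (- \<bar>x\<bar>)"
proof -
  have "exp \<bar>x\<bar> \<le> 2 * cosh x"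
    using exp_ge_zero[of x] exp_ge_zero[of "- x"] by (simp add: cosh_def abs_if)
  then show ?thesis
    by (simp add: exp_minus field_simps)
qed

text \<open>The ratio v / u = - exp x is the same for all j, and the squared amplitude is 2 (cosh
  x)^(1 - 2 j). For j = 1 this decays exactly at the rate required of kernel spinors.\<close>

lemma sech_ground_state:
  fixes j :: nat
  defines "u \<equiv> \<lambda>x::real. exp (- x / 2) / cosh x ^ j" and "v \<equiv> \<lambda>x. - exp (x / 2) / cosh x ^ j"
  shows "zs_solution (\<lambda>x. real j / cosh x) (real j - 1 / 2) u v"
    and "j \<ge> 1 \<Longrightarrow> (u x)\<^sup>2 + (v x)\<^sup>2 \<le> 4 * exp (- \<bar>x\<bar>)"
proof -
  have [simp]: "cosh y \<noteq> 0" for y :: real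
    using cosh_real_pos[of y] by simp
  have e: "exp y = cosh y + sinh y" "exp (- y) = cosh y - sinh y" for y :: real
    by (simp_all add: cosh_plus_sinh cosh_minus_sinh)
  have pow: "((\<lambda>y. c / cosh y ^ j) has_real_derivative - (c * (real j * sinh y / cosh y) / cosh y ^ j)) (at y)" for c y :: real
  proof -
    have "((\<lambda>y. cosh y ^ j) has_real_derivative real j * sinh y / cosh y * cosh y ^ j) (at y)"
      by (rule DERIV_cong[OF DERIV_power[OF has_field_derivative_cosh[OF DERIV_ident]]]) (cases j; simp)
    from DERIV_divide[OF DERIV_const[of c] this] show ?thesis
      by (simp add: field_simps)
  qed
  show "zs_solution (\<lambda>x. real j / cosh x) (real j - 1 / 2) u v"
    unfolding zs_solution_real_iff
  proof (intro conjI allI)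
    fix y :: real
    \<comment> \<open>Trading exp (y / 2) for exp (- y / 2) puts each equation over a single
      exponential, leaving an identity in cosh and sinh.\<close>
    have half: "exp (y / 2) = exp (- y / 2) * (cosh y + sinh y)" "exp (- y / 2) = exp (y / 2) * (cosh y - sinh y)"
      by (simp_all flip: e exp_add)
    define a where "a = exp (- y / 2) / cosh y ^ j"
    define b where "b = exp (y / 2) / cosh y ^ j"
    have ab: "b = a * (cosh y + sinh y)" "a = b * (cosh y - sinh y)"
      unfolding a_def b_def using half by (auto simp: field_simps)
    have "(u has_real_derivative - a / 2 - real j * sinh y / cosh y * a) (at y)"
    proof -
      have "((\<lambda>x. exp (- x / 2)) has_real_derivative - exp (- y / 2) / 2) (at y)"
        by (auto intro!: derivative_eq_intros)
      from DERIV_cong[OF DERIV_mult[OF this pow[of 1 y]]] show ?thesis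
        by (simp add: u_def a_def field_simps)
    qed
    moreover have "- a / 2 - real j * sinh y / cosh y * a = (real j - 1 / 2) * a + real j / cosh y * (- b)"
      unfolding ab(1) by (simp add: field_simps)
    ultimately show "(u has_real_derivative (real j - 1 / 2) * u y + real j / cosh y * v y) (at y)"
      by (simp add: u_def v_def a_def b_def)
    have "(v has_real_derivative - b / 2 + real j * sinh y / cosh y * b) (at y)"
    proof -
      have "((\<lambda>x. exp (x / 2)) has_real_derivative exp (y / 2) / 2) (at y)"
        by (auto intro!: derivative_eq_intros)
      from DERIV_cong[OF DERIV_mult[OF this pow[of "- 1" y]]] show ?thesis
        by (simp add: v_def b_def field_simps)
    qed
    moreover have "- b / 2 + real j * sinh y / cosh y * b = - ((real j - 1 / 2) * (- b)) - real j / cosh y * a"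
      unfolding ab(2) by (simp add: field_simps)
    ultimately show "(v has_real_derivative - ((real j - 1 / 2) * v y) - real j / cosh y * u y) (at y)"
      by (simp add: u_def v_def a_def b_def)
  qed
  assume "j \<ge> 1"
  have "(u x)\<^sup>2 + (v x)\<^sup>2 = 2 * cosh x / cosh x ^ (2 * j)"
  proof -
    have "(exp (- x / 2))\<^sup>2 + (exp (x / 2))\<^sup>2 = 2 * cosh x"
      by (simp add: power2_eq_square cosh_def flip: exp_add)
    then show ?thesis
      by (simp add: u_def v_def power_divide power_mult mult.commute[of 2 j] flip: add_divide_distrib)
  qed
  also have "\<dots> \<le> 2 * cosh x / cosh x ^ 2"
    \<comment> \<open>Here cosh x \<ge> 1 and 2 j \<ge> 2 are used.\<close>
    using \<open>j \<ge> 1\<close> cosh_real_ge_1[of x] by (intro divide_left_mono power_increasing) auto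
  also have "\<dots> = 2 * (1 / cosh x)"
    by (simp add: power2_eq_square)
  also have "\<dots> \<le> 4 * exp (- \<bar>x\<bar>)"
    using inverse_cosh_le[of x] by simp
  finally show "(u x)\<^sup>2 + (v x)\<^sup>2 \<le> 4 * exp (- \<bar>x\<bar>)" .
qed

text \<open>The inverse of the Darboux transformation with respect to the ground state of
  \<open>(m + 1) / cosh x\<close>, at which \<open>bs_cos = - tanh x\<close> and \<open>bs_sin = - 1 / cosh x\<close>, after flipping the sign
  of \<open>v\<close> to turn the potential \<open>- m / cosh x\<close> into \<open>m / cosh x\<close>.\<close>

lemma sech_ladder:
  fixes u v :: "real \<Rightarrow> real" and m l :: real
  assumes zs: "zs_solution (\<lambda>x. m / cosh x) l u v"
  defines "K \<equiv> m + 1 / 2"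
  defines "u' \<equiv> \<lambda>x. l * u x - K * (tanh x * u x - v x / cosh x)"
    and "v' \<equiv> \<lambda>x. - l * v x - K * (u x / cosh x + tanh x * v x)"
  shows "zs_solution (\<lambda>x. (m + 1) / cosh x) l u' v'"
    and "(u' x)\<^sup>2 + (v' x)\<^sup>2 \<le> 2 * (l\<^sup>2 + K\<^sup>2) * ((u x)\<^sup>2 + (v x)\<^sup>2)"
    and "l\<^sup>2 \<noteq> K\<^sup>2 \<Longrightarrow> u 0 \<noteq> 0 \<or> v 0 \<noteq> 0 \<Longrightarrow> u' 0 \<noteq> 0 \<or> v' 0 \<noteq> 0"
proof -
  have nz [simp]: "cosh y \<noteq> 0" for y :: real
    using cosh_real_pos[of y] by simp
  define t s where "t y = tanh y" and "s y = 1 / cosh y" for y :: real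
  have ts: "(t y)\<^sup>2 + (s y)\<^sup>2 = 1" for y
  proof -
    have "(t y)\<^sup>2 + (s y)\<^sup>2 = ((sinh y)\<^sup>2 + 1) / (cosh y)\<^sup>2"
      by (simp add: t_def s_def tanh_def power_divide add_divide_distrib)
    then show ?thesis
      by (simp flip: cosh_square_eq)
  qed
  have t': "(t has_real_derivative (s y)\<^sup>2) (at y)" for y
    unfolding t_def by (rule DERIV_cong[OF has_field_derivative_tanh[OF _ DERIV_ident]]) (use ts[of y] in \<open>auto simp: t_def\<close>)
  have s': "(s has_real_derivative - s y * t y) (at y)" for y
    unfolding s_def t_def tanh_def by (auto intro!: derivative_eq_intros simp: power2_eq_square)
  have u'_eq: "u' = (\<lambda>x. l * u x - K * (t x * u x - s x * v x))"
    and v'_eq: "v' = (\<lambda>x. - l * v x - K * (s x * u x + t x * v x))"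
    by (simp_all add: u'_def v'_def t_def s_def fun_eq_iff)
  have zs': "zs_solution (\<lambda>x. m * s x) l u v"
    using zs by (simp add: s_def)
  show "zs_solution (\<lambda>x. (m + 1) / cosh x) l u' v'"
    unfolding zs_solution_real_iff
  proof (intro conjI allI)
    fix y :: real
    let ?U = "l * u y + m * s y * v y" and ?V = "- (l * v y) - m * s y * u y"
    have "(u' has_real_derivative l * ?U -
        K * (((s y)\<^sup>2 * u y + t y * ?U) - (- s y * t y * v y + s y * ?V))) (at y)"
      unfolding u'_eq by (auto intro!: derivative_eq_intros t' s' zs_solution_realD[OF zs'] simp: algebra_simps)
    moreover have "l * ?U - K * (((s y)\<^sup>2 * u y + t y * ?U) - (- s y * t y * v y + s y * ?V))
        = l * u' y + (m + 1) * s y * v' y"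
      unfolding u'_eq v'_eq K_def by (simp add: field_simps power2_eq_square)
    ultimately show "(u' has_real_derivative l * u' y + (m + 1) / cosh y * v' y) (at y)"
      by (simp add: s_def)
    have "(v' has_real_derivative - l * ?V -
        K * ((- s y * t y * u y + s y * ?U) + ((s y)\<^sup>2 * v y + t y * ?V))) (at y)"
      unfolding v'_eq by (auto intro!: derivative_eq_intros t' s' zs_solution_realD[OF zs'] simp: algebra_simps)
    moreover have "- l * ?V - K * ((- s y * t y * u y + s y * ?U) + ((s y)\<^sup>2 * v y + t y * ?V))
        = - (l * v' y) - (m + 1) * s y * u' y"
      unfolding u'_eq v'_eq K_def by (simp add: field_simps power2_eq_square)
    ultimately show "(v' has_real_derivative - (l * v' y) - (m + 1) / cosh y * u' y) (at y)"
      by (simp add: s_def)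
  qed
  \<comment> \<open>Parallelogram law for l (u, - v) and K times the rotation of (u, v) given by t
    and s; the bracket on the right is the squared norm of their sum.\<close>
  have "2 * (l\<^sup>2 + K\<^sup>2) * ((u x)\<^sup>2 + (v x)\<^sup>2) = (u' x)\<^sup>2 + (v' x)\<^sup>2 +
      ((l * u x + K * (t x * u x - s x * v x))\<^sup>2 + (- l * v x + K * (s x * u x + t x * v x))\<^sup>2)"
    unfolding u'_eq v'_eq using ts[of x] by algebra
  then show "(u' x)\<^sup>2 + (v' x)\<^sup>2 \<le> 2 * (l\<^sup>2 + K\<^sup>2) * ((u x)\<^sup>2 + (v x)\<^sup>2)"
    by simp
  assume lK: "l\<^sup>2 \<noteq> K\<^sup>2" and "u 0 \<noteq> 0 \<or> v 0 \<noteq> 0"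
  show "u' 0 \<noteq> 0 \<or> v' 0 \<noteq> 0"
  proof (rule ccontr)
    assume "\<not> ?thesis"
    \<comment> \<open>At 0, tanh is 0 and cosh is 1, so the map is a constant matrix whose
      determinant is K^2 - l^2.\<close>
    then have "l * u 0 + K * v 0 = 0" "l * v 0 + K * u 0 = 0"
      by (auto simp: u'_def v'_def)
    then have "(l\<^sup>2 - K\<^sup>2) * u 0 = 0" "(l\<^sup>2 - K\<^sup>2) * v 0 = 0"
      by algebra+
    then show False
      using lK \<open>u 0 \<noteq> 0 \<or> v 0 \<noteq> 0\<close> by simp
  qed
qed

text \<open>Start from the ground state of j / cosh x and climb N - j rungs of the ladder. On each
  rung j - 1/2 stays below N + 1/2, so the solution does not die, and only the constant C
  grows.\<close>

lemma sech_state: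
  assumes "1 \<le> j" "j \<le> N"
  shows "\<exists>u v C. zs_solution (\<lambda>x. real N / cosh x) (real j - 1 / 2) u v \<and> (u 0 \<noteq> 0 \<or> v 0 \<noteq> 0) \<and>
    (\<forall>x. (u x)\<^sup>2 + (v x)\<^sup>2 \<le> C * exp (- \<bar>x\<bar>))"
  using assms(2)
proof (induction N rule: dec_induct)
  case base
  show ?case
    using sech_ground_state[of j] assms(1)
    by (intro exI[of _ "\<lambda>x::real. exp (- x / 2) / cosh x ^ j"] exI[of _ "\<lambda>x. - exp (x / 2) / cosh x ^ j"] exI[of _ 4]) auto
next
  case (step N)
  then obtain u v C where zs: "zs_solution (\<lambda>x. real N / cosh x) (real j - 1 / 2) u v"
    and nz: "u 0 \<noteq> 0 \<or> v 0 \<noteq> 0" and C: "\<And>x. (u x)\<^sup>2 + (v x)\<^sup>2 \<le> C * exp (- \<bar>x\<bar>)"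
    by blast
  define A where "A = 2 * ((real j - 1 / 2)\<^sup>2 + (real N + 1 / 2)\<^sup>2)"
  have "(real j - 1 / 2)\<^sup>2 < (real N + 1 / 2)\<^sup>2"
    using step.hyps assms(1) by (intro power_strict_mono) auto
  then have ne: "(real j - 1 / 2)\<^sup>2 \<noteq> (real N + 1 / 2)\<^sup>2"
    by simp
  note ladder = sech_ladder[OF zs, folded A_def]
  have "A * ((u x)\<^sup>2 + (v x)\<^sup>2) \<le> A * C * exp (- \<bar>x\<bar>)" for x
    using mult_left_mono[OF C, of A x] by (simp add: A_def mult.assoc)
  then show ?case
    using ladder(1) ladder(3)[OF ne nz] order_trans[OF ladder(2)]
    by (simp only: of_nat_Suc add.commute[of 1]) blast
qed

section \<open>Kernel spinors from bound states and the lower bound for the dimension\<close>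

lemma mode_spinor_in_kernel:
  assumes zs: "zs_solution (\<lambda>x. 2 * U x) k u v" and U: "continuous_on UNIV U" and k: "k \<in> half_odd"
    and C: "\<And>x. (u x)\<^sup>2 + (v x)\<^sup>2 \<le> C * exp (- \<bar>x\<bar>)"
  shows "mode_spinor k u v \<in> dirac_kernel U"
proof -
  let ?\<psi> = "mode_spinor k u v"
  let ?u' = "\<lambda>x. k * u x + 2 * U x * v x" and ?v' = "\<lambda>x. - (k * v x) - 2 * U x * u x"
  note d = zs_solution_realD[OF zs]
  \<comment> \<open>The embeddings of the two components reduce differentiation of the spinor to
    products of complex functions.\<close>
  define L where "L c = (vector [c, 0] :: complex ^ 2)" for c
  define R where "R c = (vector [0, c] :: complex ^ 2)" for c
  have L: "bounded_linear L" and R: "bounded_linear R"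
    by (auto intro!: linear_conv_bounded_linear[THEN iffD1] linearI simp: L_def R_def vec_eq_iff forall_2)
  have eq: "mode_spinor k f g = (\<lambda>p. L (of_real (f (fst p)) * cis (k * snd p)) + R (of_real (g (fst p)) * cis (k * snd p)))" for f g
    by (simp add: fun_eq_iff mode_spinor_def L_def R_def vec_eq_iff forall_2)
  have diff: "?\<psi> differentiable (at p)" for p
  proof -
    have w: "(\<lambda>p. complex_of_real (w (fst p))) differentiable (at p)" if "\<And>x. (w has_real_derivative w' x) (at x)" for w w'
      using has_derivative_compose[OF has_derivative_fst[OF has_derivative_ident]
          has_vector_derivative_of_real[OF that, unfolded has_vector_derivative_def]]
      unfolding differentiable_def by blast
    have c: "(\<lambda>p. cis (k * snd p)) differentiable (at p)"
      using has_derivative_compose[OF has_derivative_snd[OF has_derivative_ident]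
          cis_has_vector_derivative[unfolded has_vector_derivative_def]]
      unfolding differentiable_def by blast
    have lin: "(\<lambda>p. T (f p)) differentiable (at p)" if "bounded_linear T" "f differentiable (at p)" for T f
      using bounded_linear.has_derivative[OF that(1)] that(2) unfolding differentiable_def by blast
    show ?thesis
      unfolding eq
      by (intro differentiable_add lin[OF L] lin[OF R] differentiable_mult w[OF d(1)] w[OF d(2)] c)
  qed
  have px: "partial_x ?\<psi> = mode_spinor k ?u' ?v'"
  proof
    fix p :: "real \<times> real"
    have "((\<lambda>t. ?\<psi> (t, snd p)) has_vector_derivative mode_spinor k ?u' ?v' p) (at (fst p))"
      unfolding eq fst_conv snd_conv
      by (intro has_vector_derivative_add bounded_linear.has_vector_derivative[OF L]
          bounded_linear.has_vector_derivative[OF R] has_vector_derivative_mult_left has_vector_derivative_of_real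
          d)
    then show "partial_x ?\<psi> p = mode_spinor k ?u' ?v' p"
      by (simp add: partial_x_def case_prod_beta vector_derivative_at)
  qed
  have py: "partial_y ?\<psi> = (\<lambda>p. (\<i> * of_real k) *s ?\<psi> p)"
  proof
    fix p :: "real \<times> real"
    have "((\<lambda>t. ?\<psi> (fst p, t)) has_vector_derivative
        L (of_real (u (fst p)) * (\<i> * of_real k * cis (k * snd p))) + R (of_real (v (fst p)) * (\<i> * of_real k * cis (k * snd p)))) (at (snd p))"
      unfolding eq fst_conv snd_conv
      by (intro has_vector_derivative_add bounded_linear.has_vector_derivative[OF L]
          bounded_linear.has_vector_derivative[OF R] has_vector_derivative_mult_right cis_has_vector_derivative)
    moreover have "L (of_real (u (fst p)) * (\<i> * of_real k * cis (k * snd p))) + R (of_real (v (fst p)) * (\<i> * of_real k * cis (k * snd p)))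
        = (\<i> * of_real k) *s ?\<psi> p"
      by (simp add: L_def R_def mode_spinor_def vec_eq_iff forall_2)
    ultimately show "partial_y ?\<psi> p = (\<i> * of_real k) *s ?\<psi> p"
      by (simp add: partial_y_def case_prod_beta vector_derivative_at)
  qed
  have cont: "continuous_on UNIV (mode_spinor k f g)" if fg: "continuous_on UNIV f" "continuous_on UNIV g" for f g
    unfolding eq
    by (intro continuous_on_add bounded_linear.continuous_on[OF L] bounded_linear.continuous_on[OF R]
        continuous_intros continuous_on_compose2[OF fg(1)] continuous_on_compose2[OF fg(2)]) auto
  have cuv: "continuous_on UNIV u" "continuous_on UNIV v"
    using d by (auto intro!: continuous_at_imp_continuous_on DERIV_isCont)
  have norm_le: "(norm (?\<psi> (x, y)))\<^sup>2 \<le> C * exp (- \<bar>x\<bar>)" for x y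
    using C[of x] by (simp add: norm_vec_def L2_set_def sum_2 mode_spinor_nth norm_mult)
  have "C1_spinor ?\<psi>"
    unfolding C1_spinor_def
  proof (intro conjI allI diff)
    show "continuous_on UNIV (partial_x ?\<psi>)"
      unfolding px by (intro cont continuous_intros cuv U)
    have "(\<lambda>p. (\<i> * of_real k) *s ?\<psi> p) = (\<lambda>p. \<chi> i. (\<i> * of_real k) * ?\<psi> p $ i)"
      by (simp add: fun_eq_iff vector_scalar_mult_def)
    then show "continuous_on UNIV (partial_y ?\<psi>)"
      unfolding py by (simp only:) (intro continuous_intros cont cuv)
  qed
  moreover have "dirac U ?\<psi> p = 0" for p
    unfolding dirac_eq_0_iff[OF diff] px py
    by (simp add: mode_spinor_nth algebra_simps)
  moreover have "?\<psi> (x, y + 2 * pi) = - ?\<psi> (x, y)" for x y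
    by (simp add: vec_eq_iff mode_spinor_nth cis_half_odd[OF k])
  moreover have "\<exists>C. \<forall>\<^sub>F x in at_infinity. \<forall>y. (norm (?\<psi> (x, y)))\<^sup>2 \<le> C * exp (- \<bar>x\<bar>)"
    by (intro exI[of _ C] always_eventually allI norm_le)
  ultimately show ?thesis
    unfolding dirac_kernel_def by blast
qed

lemma mode_mode_spinor:
  assumes "k \<in> half_odd" "l \<in> half_odd"
  shows "mode (mode_spinor k u v) l i x = (if k = l then of_real (if i = 1 then u x else v x) else 0)"
  unfolding mode_def mode_spinor_nth fst_conv snd_conv fourier_coeff_cis[OF assms(2,1)] by auto

text \<open>Membership in the kernel is carried through the induction because additivity of
  \<open>fourier_coeff\<close> needs continuous summands.\<close>

lemma mode_span:
  assumes "\<psi> \<in> spinor.span S" "\<And>\<phi>. \<phi> \<in> S \<Longrightarrow> \<phi> \<in> dirac_kernel U \<and> mode \<phi> k i x = 0"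
  shows "\<psi> \<in> dirac_kernel U \<and> mode \<psi> k i x = 0"
  using assms(1)
proof (induction rule: spinor.span_induct_alt)
  case base
  show ?case
    by (intro conjI spinor.subspace_0[OF subspace_dirac_kernel]) (simp add: mode_def fourier_coeff_def)
next
  case (step c \<phi> \<psi>)
  have ker: "spinor_scale c \<phi> \<in> dirac_kernel U" "\<psi> \<in> dirac_kernel U" "\<phi> \<in> dirac_kernel U"
    using step assms(2) by (auto intro: spinor.subspace_scale[OF subspace_dirac_kernel])
  have slice: "continuous_on UNIV (\<lambda>y. f (x, y) $ i)" if "f \<in> dirac_kernel U" for f
    by (intro continuous_intros continuous_on_compose2[OF dirac_kernelD(2)[OF that]]) auto
  have "mode (spinor_scale c \<phi> + \<psi>) k i x = mode (spinor_scale c \<phi>) k i x + mode \<psi> k i x"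
    using fourier_coeff_add[OF slice[OF ker(1)] slice[OF ker(2)]] by (simp add: mode_def)
  also have "mode (spinor_scale c \<phi>) k i x = c * mode \<phi> k i x"
    by (simp add: mode_def spinor_scale_def fourier_coeff_mult)
  finally show ?case
    using step assms(2) by (intro conjI spinor.subspace_add[OF subspace_dirac_kernel ker(1,2)]) simp
qed

text \<open>The spinors for the 2 N frequencies j - 1/2 and their negatives are independent, because
  the mode at one frequency kills all the others. The finite spanning set rules out the default
  value 0 of \<open>spinor.dim\<close>.\<close>

lemma dim_dirac_kernel_sech:
  assumes fin: "finite S" "dirac_kernel (\<lambda>x. real N / (2 * cosh x)) \<subseteq> spinor.span S"
  shows "2 * N \<le> spinor.dim (dirac_kernel (\<lambda>x. real N / (2 * cosh x)))"
proof -
  define U where "U = (\<lambda>x. real N / (2 * cosh x))"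
  have U: "continuous_on UNIV U"
    unfolding U_def by (intro continuous_intros) auto
  have q: "(\<lambda>x. 2 * U x) = (\<lambda>x. real N / cosh x)"
    by (simp add: U_def fun_eq_iff field_simps)
  define P where "P = (\<lambda>j. real j - 1 / 2) ` {1..N}"
  define K where "K = P \<union> uminus ` P"
  have "real j - 1 / 2 = of_int (int j - 1) + 1 / 2" for j
    by simp
  then have P_half_odd: "P \<subseteq> half_odd"
    unfolding P_def half_odd_def by blast
  have K_half_odd: "k \<in> half_odd" if "k \<in> K" for k
    using that P_half_odd half_odd_uminus by (auto simp: K_def)
  have P_pos: "k > 0" if "k \<in> P" for k
    using that by (auto simp: P_def)
  have "card P = N"
    unfolding P_def by (subst card_image) (auto simp: inj_on_def)
  moreover have "P \<inter> uminus ` P = {}"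
    by (auto dest!: P_pos)
  ultimately have "card K = 2 * N"
    unfolding K_def by (subst card_Un_disjoint) (auto simp: P_def card_image)
  have "\<exists>u v. (u 0 \<noteq> 0 \<or> v 0 \<noteq> 0) \<and> mode_spinor k u v \<in> dirac_kernel U" if k: "k \<in> K" for k
  proof -
    have pos: "\<exists>u v C. zs_solution (\<lambda>x. 2 * U x) l u v \<and> (u 0 \<noteq> 0 \<or> v 0 \<noteq> 0) \<and> (\<forall>x. (u x)\<^sup>2 + (v x)\<^sup>2 \<le> C * exp (- \<bar>x\<bar>))"
      if "l \<in> P" for l
      using that sech_state[of _ N] by (auto simp: P_def q)
    have "\<exists>u v C. zs_solution (\<lambda>x. 2 * U x) k u v \<and> (u 0 \<noteq> 0 \<or> v 0 \<noteq> 0) \<and> (\<forall>x. (u x)\<^sup>2 + (v x)\<^sup>2 \<le> C * exp (- \<bar>x\<bar>))"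
    proof (cases "k \<in> P")
      case False
      then have "- k \<in> P"
        using k by (auto simp: K_def)
      then obtain u v C where *: "zs_solution (\<lambda>x. 2 * U x) (- k) u v" "u 0 \<noteq> 0 \<or> v 0 \<noteq> 0"
        "\<And>x. (u x)\<^sup>2 + (v x)\<^sup>2 \<le> C * exp (- \<bar>x\<bar>)"
        using pos by blast
      then show ?thesis
        using zs_solution_swap[OF *(1)]
        by (intro exI[of _ v] exI[of _ "\<lambda>x. - u x"] exI[of _ C]) (auto simp: add.commute)
    qed (use pos in blast)
    then show ?thesis
      using mode_spinor_in_kernel[OF _ U K_half_odd[OF k]] by blast
  qed
  then obtain u v where nz: "u k 0 \<noteq> 0 \<or> v k 0 \<noteq> 0"
    and ker: "mode_spinor k (u k) (v k) \<in> dirac_kernel U" if "k \<in> K" for k :: real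
    by metis
  define M where "M k = mode_spinor k (u k) (v k)" for k
  have mode_M: "mode (M k) l i 0 = 0" if "k \<in> K" "l \<in> K" "k \<noteq> l" for k l i
    using mode_mode_spinor[OF K_half_odd K_half_odd] that by (simp add: M_def)
  have mode_M_nz: "\<exists>i. mode (M k) k i 0 \<noteq> 0" if k: "k \<in> K" for k
    using mode_mode_spinor[OF K_half_odd[OF k] K_half_odd[OF k]] nz[OF k]
    by (cases "u k 0 = 0") (auto simp: M_def intro: exI[of _ 1] exI[of _ 2])
  have "inj_on M K"
    using mode_M mode_M_nz unfolding inj_on_def by metis
  have "spinor.independent (M ` K)"
    unfolding spinor.dependent_def
  proof safe
    fix k assume k: "k \<in> K" and span: "M k \<in> spinor.span (M ` K - {M k})"
    have "mode (M k) k i 0 = 0" for i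
      using mode_span[OF span, of U k i 0] mode_M ker k unfolding M_def[symmetric] by auto
    then show False
      using mode_M_nz[OF k] by blast
  qed
  moreover have "M ` K \<subseteq> dirac_kernel U"
    using ker by (auto simp: M_def)
  \<comment> \<open>A basis of the kernel containing the 2 N spinors; its cardinality is the
    dimension, and its finiteness makes cardinalities comparable.\<close>
  ultimately obtain B where B: "M ` K \<subseteq> B" "B \<subseteq> dirac_kernel U" "spinor.independent B" "dirac_kernel U \<subseteq> spinor.span B"
    using spinor.maximal_independent_subset_extend by metis
  have "finite B"
    using spinor.independent_span_bound[OF fin(1) B(3)] B(2) fin(2) unfolding U_def by blast
  have "2 * N = card (M ` K)"
    using card_image[OF \<open>inj_on M K\<close>] \<open>card K = 2 * N\<close> by simp
  also have "\<dots> \<le> card B"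
    by (rule card_mono[OF \<open>finite B\<close> B(1)])
  also have "\<dots> = spinor.dim (dirac_kernel U)"
    by (rule spinor.basis_card_eq_dim[OF B(2,4,3)])
  finally show ?thesis
    unfolding U_def .
qed

section \<open>The energy inequality\<close>

text \<open>The antiderivative tanh runs from - 1 to 1. The function yields the energy of the
  extremal potential and also dominates in \<open>square_integrable_if_bigo\<close>.\<close>

lemma integral_inverse_cosh_square:
  "integrable lborel (\<lambda>x::real. 1 / (cosh x)\<^sup>2)" "(\<integral>x. 1 / (cosh (x::real))\<^sup>2 \<partial>lborel) = 2"
proof -
  have nz: "cosh y \<noteq> 0" for y :: real
    using cosh_real_pos[of y] by simp
  have "(tanh has_real_derivative 1 / (cosh x)\<^sup>2) (at x)" for x :: real
  proof (rule DERIV_cong[OF has_field_derivative_tanh[OF nz DERIV_ident]])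
    have "1 - (tanh x)\<^sup>2 = ((cosh x)\<^sup>2 - (sinh x)\<^sup>2) / (cosh x)\<^sup>2"
      using nz[of x] by (simp add: tanh_def power_divide diff_divide_distrib)
    then show "(1 - (tanh x)\<^sup>2) * 1 = 1 / (cosh x)\<^sup>2"
      by (simp add: cosh_square_eq)
  qed
  moreover have "isCont (\<lambda>x. 1 / (cosh x)\<^sup>2) x" for x :: real
    using nz by (intro continuous_intros) auto
  moreover have "((tanh \<circ> real_of_ereal) \<longlongrightarrow> - 1) (at_right (- \<infinity>))" "((tanh \<circ> real_of_ereal) \<longlongrightarrow> (1::real)) (at_left \<infinity>)"
    using tanh_real_at_bot tanh_real_at_top by (simp_all add: ereal_tendsto_simps)
  ultimately have "set_integrable lborel (einterval (- \<infinity>) \<infinity>) (\<lambda>x::real. 1 / (cosh x)\<^sup>2)"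
    "(LBINT x=- \<infinity>..\<infinity>. 1 / (cosh (x::real))\<^sup>2) = 1 - (- 1)"
    using interval_integral_FTC_nonneg[of "- \<infinity>" \<infinity> tanh "\<lambda>x. 1 / (cosh x)\<^sup>2" "- 1" 1] by auto
  then show "integrable lborel (\<lambda>x::real. 1 / (cosh x)\<^sup>2)" "(\<integral>x. 1 / (cosh (x::real))\<^sup>2 \<partial>lborel) = 2"
    by (simp_all add: interval_lebesgue_integral_def set_integrable_def set_lebesgue_integral_def einterval_def)
qed

text \<open>U cosh is bounded: by compactness on [- b, b], and outside because cosh x \<le> exp
  |x|.\<close>

lemma square_integrable_if_bigo:
  fixes U :: "real \<Rightarrow> real"
  assumes U: "continuous_on UNIV U" and O: "U \<in> O[at_infinity](\<lambda>x. exp (- \<bar>x\<bar>))"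
  shows "integrable lborel (\<lambda>x. (U x)\<^sup>2)"
proof -
  obtain c where c: "c > 0" "\<forall>\<^sub>F x in at_infinity. norm (U x) \<le> c * norm (exp (- \<bar>x\<bar>))"
    using landau_o.bigE[OF O] by blast
  then obtain b where b: "\<bar>U x\<bar> \<le> c * exp (- \<bar>x\<bar>)" if "\<bar>x\<bar> \<ge> b" for x
    by (auto simp: eventually_at_infinity)
  have "continuous_on {- b..b} (\<lambda>x. U x * cosh x)"
    by (intro continuous_intros continuous_on_subset[OF U]) auto
  then have "bounded ((\<lambda>x. U x * cosh x) ` {- b..b})"
    by (intro compact_imp_bounded compact_continuous_image) auto
  then obtain a where a: "\<forall>x\<in>{- b..b}. \<bar>U x * cosh x\<bar> \<le> a"
    unfolding bounded_iff real_norm_def by blast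
  define M where "M = max a c"
  have cosh_pos: "cosh x > 0" for x :: real
    by (rule cosh_real_pos)
  have M: "\<bar>U x * cosh x\<bar> \<le> M" for x
  proof (cases "\<bar>x\<bar> \<ge> b")
    case True
    have "cosh x \<le> exp \<bar>x\<bar>"
      by (cases "x \<ge> 0") (simp_all add: cosh_def)
    then have "\<bar>U x * cosh x\<bar> \<le> (c * exp (- \<bar>x\<bar>)) * exp \<bar>x\<bar>"
      unfolding abs_mult using b[OF True] cosh_pos[of x] c(1) by (intro mult_mono) auto
    also have "\<dots> = c"
      by (simp add: exp_minus)
    finally show ?thesis
      by (simp add: M_def)
  next
    case False
    then have "x \<in> {- b..b}" by auto
    then show ?thesis
      using a by (fastforce simp: M_def)
  qed
  show ?thesis
  proof (rule Bochner_Integration.integrable_bound)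
    show "integrable lborel (\<lambda>x::real. M\<^sup>2 * (1 / (cosh x)\<^sup>2))"
      by (intro integrable_mult_right integral_inverse_cosh_square)
    show "(\<lambda>x. (U x)\<^sup>2) \<in> borel_measurable lborel"
      using borel_measurable_continuous_onI[OF U] by measurable
    have "(U x)\<^sup>2 \<le> M\<^sup>2 * (1 / (cosh x)\<^sup>2)" for x
    proof -
      have "(U x * cosh x)\<^sup>2 \<le> M\<^sup>2"
        using power_mono[OF M[of x], of 2] by simp
      then show ?thesis
        using cosh_pos[of x] by (simp add: field_simps power_mult_distrib)
    qed
    then show "AE x in lborel. norm ((U x)\<^sup>2) \<le> norm (M\<^sup>2 * (1 / (cosh x)\<^sup>2))"
      by simp
  qed
qed

lemma bounded_antiderivative:
  fixes h :: "real \<Rightarrow> real"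
  assumes h: "continuous_on UNIV h" and int: "integrable lborel h" and nonneg: "\<And>x. h x \<ge> 0"
  obtains Q where "\<And>x. (Q has_real_derivative h x) (at x)" "\<And>x. 0 \<le> Q x" "\<And>x. Q x \<le> (\<integral>x. h x \<partial>lborel)"
proof
  define Q where "Q x = integral {..x} h" for x
  have int_on: "h integrable_on S" if "S \<in> sets borel" for S
    using that by (intro set_borel_integral_eq_integral(1) integrable_mult_indicator[OF _ int, unfolded set_integrable_def[symmetric]]) auto
  have int_UNIV: "integral UNIV h = (\<integral>x. h x \<partial>lborel)"
    using int by (simp add: integral_lborel)
  show "0 \<le> Q x" for x
    unfolding Q_def using nonneg by (intro integral_nonneg int_on) auto
  show "Q x \<le> (\<integral>x. h x \<partial>lborel)" for x
    unfolding Q_def int_UNIV[symmetric] using nonneg by (intro integral_subset_le int_on) auto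
  show "(Q has_real_derivative h x) (at x)" for x
  proof -
    \<comment> \<open>The fundamental theorem is applied on a compact interval around x; the
      integral up to x - 1 is a constant.\<close>
    have "((\<lambda>t. integral {x - 1..t} h) has_real_derivative h x) (at x within {x - 1..x + 1})"
      by (rule integral_has_real_derivative[OF continuous_on_subset[OF h]]) auto
    then have "((\<lambda>t. integral {x - 1..t} h) has_real_derivative h x) (at x)"
      by (subst (asm) at_within_interior) (auto simp: interior_atLeastAtMost_real)
    then have "((\<lambda>t. integral {..x - 1} h + integral {x - 1..t} h) has_real_derivative h x) (at x)"
      by (auto intro!: derivative_eq_intros)
    moreover have "\<forall>\<^sub>F t in nhds x. Q t = integral {..x - 1} h + integral {x - 1..t} h"
    proof -
      have "\<forall>\<^sub>F t in nhds x. t > x - 1"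
        using eventually_nhds_in_open[of "{x - 1<..}" x] by simp
      then show ?thesis
      proof eventually_elim
        case (elim t)
        have "negligible ({..x - 1} \<inter> {x - 1..t})"
          by (rule negligible_subset[OF negligible_sing[of "x - 1"]]) auto
        moreover have "{..t} = {..x - 1} \<union> {x - 1..t}"
          using elim by auto
        ultimately show ?case
          unfolding Q_def by (simp only:) (intro integral_Un int_on; simp)
      qed
    qed
    ultimately show ?thesis
      by (simp add: DERIV_cong_ev)
  qed
qed

lemma kernel_nonzero_if_dim_pos:
  assumes "spinor.dim (dirac_kernel U) > 0"
  obtains \<psi> where "\<psi> \<in> dirac_kernel U" "\<psi> \<noteq> 0"
proof (cases "dirac_kernel U \<subseteq> {0}")
  case True
  then have "dirac_kernel U \<subseteq> spinor.span {}"
    by (simp only: spinor.span_empty)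
  then have "spinor.dim (dirac_kernel U) \<le> card ({} :: spinor set)"
    by (rule spinor.dim_le_card) simp
  with assms show ?thesis by simp
qed (use that in blast)

lemma admissible_dim: "admissible N U \<longleftrightarrow> U \<in> O[at_infinity](\<lambda>x. exp (- \<bar>x\<bar>)) \<and> 2 * N \<le> spinor.dim (dirac_kernel U)"
  unfolding admissible_def quaternionic_dim_def by linarith

text \<open>The Zakharov-Shabat potential is 2 U; the resulting factor 4 cancels the one in
  \<open>dim_dirac_kernel_le\<close>.\<close>

lemma energy_antiderivative:
  fixes U :: "real \<Rightarrow> real"
  assumes "continuous_on UNIV U" "U \<in> O[at_infinity](\<lambda>x. exp (- \<bar>x\<bar>))"
  obtains Q where "\<And>x. (Q has_real_derivative (2 * U x)\<^sup>2) (at x)" "\<And>x. 0 \<le> Q x"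
    "\<And>x. Q x \<le> 4 * (\<integral>x. (U x)\<^sup>2 \<partial>lborel)"
proof -
  have "continuous_on UNIV (\<lambda>x. (2 * U x)\<^sup>2)"
    by (intro continuous_intros assms)
  moreover have "integrable lborel (\<lambda>x. (2 * U x)\<^sup>2)"
    using square_integrable_if_bigo[OF assms] by (simp add: power_mult_distrib)
  moreover have "(\<integral>x. (2 * U x)\<^sup>2 \<partial>lborel) = 4 * (\<integral>x. (U x)\<^sup>2 \<partial>lborel)"
    by (simp add: power_mult_distrib)
  ultimately show ?thesis
    using bounded_antiderivative[of "\<lambda>x. (2 * U x)\<^sup>2"] that by (metis zero_le_power2)
qed

lemma energy_ge:
  assumes "N > 0" and adm: "admissible N U"
  shows "(real N)\<^sup>2 / 2 \<le> (\<integral>x. (U x)\<^sup>2 \<partial>lborel)"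
proof -
  have O: "U \<in> O[at_infinity](\<lambda>x. exp (- \<bar>x\<bar>))" and dim: "2 * N \<le> spinor.dim (dirac_kernel U)"
    using adm by (auto simp: admissible_dim)
  \<comment> \<open>As N > 0, the dimension is positive and a nonzero kernel spinor determines
    U.\<close>
  have "continuous_on UNIV U"
    using kernel_nonzero_if_dim_pos[of U] continuous_potential dim \<open>N > 0\<close>
    by (metis gr0I le_zero_eq mult_eq_0_iff zero_neq_numeral)
  then obtain Q where Q: "\<And>x. (Q has_real_derivative (2 * U x)\<^sup>2) (at x)" "\<And>x. 0 \<le> Q x"
    "\<And>x. Q x \<le> 4 * (\<integral>x. (U x)\<^sup>2 \<partial>lborel)"
    using energy_antiderivative[OF _ O] by blast
  obtain K where K: "finite K" "K \<subseteq> half_odd \<inter> {0<..}" "4 * \<Sum>K \<le> 4 * (\<integral>x. (U x)\<^sup>2 \<partial>lborel) - 0"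
    "spinor.dim (dirac_kernel U) \<le> 2 * card K"
    using dim_dirac_kernel_le[OF Q] .
  have "(real N)\<^sup>2 / 2 \<le> (real (card K))\<^sup>2 / 2"
    using dim K(4) by simp
  also have "\<dots> \<le> \<Sum>K"
    by (rule sum_half_odd_ge[OF K(1,2)])
  finally show ?thesis
    using K(3) by simp
qed

text \<open>The energy bound is applied to the extremal potential itself: it makes the kernel
  finite-dimensional, so that counting independent solutions bounds \<open>spinor.dim\<close> from
  below.\<close>

lemma admissible_sech: "admissible N (\<lambda>x. real N / (2 * cosh x))"
proof -
  let ?U = "\<lambda>x. real N / (2 * cosh x)"
  have cont: "continuous_on UNIV ?U"
    by (intro continuous_intros) auto
  have "norm (?U x) \<le> real N * norm (exp (- \<bar>x\<bar>))" for x
    using mult_left_mono[OF inverse_cosh_le[of x], of "real N / 2"] by simp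
  then have O: "?U \<in> O[at_infinity](\<lambda>x. exp (- \<bar>x\<bar>))"
    by (intro bigoI[of _ "real N"] always_eventually allI)
  obtain Q where Q: "\<And>x. (Q has_real_derivative (2 * ?U x)\<^sup>2) (at x)" "\<And>x. 0 \<le> Q x"
    "\<And>x. Q x \<le> 4 * (\<integral>x. (?U x)\<^sup>2 \<partial>lborel)"
    using energy_antiderivative[OF cont O] by blast
  obtain S where "finite S" "dirac_kernel ?U \<subseteq> spinor.span S"
    using dim_dirac_kernel_le[OF Q] by metis
  then show ?thesis
    using O dim_dirac_kernel_sech by (simp add: admissible_dim)
qed

theorem corollary3:
  fixes N :: nat
  assumes "N > 0"
  shows "(\<forall>U. admissible N U \<longrightarrow> (\<integral>x. (U x)\<^sup>2 \<partial>lborel) \<ge> (real N)\<^sup>2 / 2) \<and>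
         (INF U\<in>{U. admissible N U}. \<integral>x. (U x)\<^sup>2 \<partial>lborel) = (real N)\<^sup>2 / 2 \<and>
         admissible N (\<lambda>x. real N / (2 * cosh x)) \<and>
         (\<integral>x. (real N / (2 * cosh x))\<^sup>2 \<partial>lborel) = (real N)\<^sup>2 / 2"
proof -
  have "(\<integral>x. (real N / (2 * cosh x))\<^sup>2 \<partial>lborel) = (\<integral>x. (real N)\<^sup>2 / 4 * (1 / (cosh x)\<^sup>2) \<partial>lborel)"
    by (simp add: power_divide power_mult_distrib)
  also have "\<dots> = (real N)\<^sup>2 / 4 * 2"
    unfolding integral_mult_right_zero integral_inverse_cosh_square(2) ..
  finally have eq: "(\<integral>x. (real N / (2 * cosh x))\<^sup>2 \<partial>lborel) = (real N)\<^sup>2 / 2"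
    by simp
  have "(INF U\<in>{U. admissible N U}. \<integral>x. (U x)\<^sup>2 \<partial>lborel) = (real N)\<^sup>2 / 2"
  proof (rule cInf_eq_minimum)
    show "(real N)\<^sup>2 / 2 \<in> (\<lambda>U. \<integral>x. (U x)\<^sup>2 \<partial>lborel) ` {U. admissible N U}"
      unfolding eq[symmetric]
      by (intro image_eqI[where x = "\<lambda>x. real N / (2 * cosh x)"] refl) (simp add: admissible_sech)
  qed (use energy_ge[OF assms] in auto)
  then show ?thesis
    using energy_ge[OF assms] admissible_sech eq by blast
qed

end
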